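(* Let $f^*$ be an optimal threshold curve in the memoryless best-choice problem, i.e. a threshold curve with $J(f^* )=\sup_f J(f)$, where the supremum is over all threshold curves, and let $w^*$ be the temporal winning rate of $f^*$. Then $$\int_0^1 f^*(t)\,w^*(t)\,dt=1.$$
   Context: Let $\Pi$ be a Poisson point process of unit rate in $[0,1]\times[0,\infty)$; an atom $(t,x)$ is a score $x$ observed at time $t$. Let $(T,M)$ denote the (a.s. unique) atom of $\Pi$ with the smallest score. A threshold curve is a nondecreasing càdlàg function $f:[0,1)\to[0,\infty)$. The associated memoryless stopping point $(\tau,\xi)$ is the atom of $\Pi$ with the smallest arrival time in the subgraph $\{(t,x): x\le f(t)\}$, with $(\tau,\xi)=(1,\infty)$ if there is no such atom. Set $J(f):=\mathbb P[\tau=T]$. For a threshold curve $f$ let $F(t)=\int_0^t f(s)\,ds$, let $g$ be the generalised inverse of $f$, $g(x)=\sup\{t\in[0,1): f(t)<x\}$ (with $\sup\varnothing=0$), and $G(x)=\int_0^x g(z)\,dz$. The winning rate of $f$ is $W(t,x):=e^{-F(t)}\exp(-G(x)-x(1-t))$ for $x\le f(t)$, and the temporal winning rate of $f$ is $w(t):=\int_0^{f(t)}W(t,x)\,dx$, $t\in[0,1)$. *)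

theory Defs
  imports "HOL-Probability.Probability"
begin

definition point_count :: "'b set \<Rightarrow> 'b set \<Rightarrow> ennreal" where
  "point_count S A = emeasure (count_space UNIV) (S \<inter> A)"

text \<open>A (simple) Poisson point process with intensity measure \<open>\<mu>\<close>, encoded as a random set of
  points: \<open>X \<omega>\<close> is the set of atoms of the realisation \<open>\<omega>\<close>.\<close>

definition poisson_point_process ::
    "'a measure \<Rightarrow> ('a \<Rightarrow> 'b set) \<Rightarrow> 'b measure \<Rightarrow> bool" where
  "poisson_point_process M X \<mu> \<longleftrightarrow>
     prob_space M \<and>
     (\<forall>\<omega>\<in>space M. X \<omega> \<subseteq> space \<mu>) \<and>
     (\<forall>A\<in>sets \<mu>. (\<lambda>\<omega>. point_count (X \<omega>) A) \<in> borel_measurable M) \<and>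
     (\<forall>A\<in>sets \<mu>.
        if emeasure \<mu> A = \<infinity> then AE \<omega> in M. point_count (X \<omega>) A = \<infinity>
        else \<forall>k::nat. measure M {\<omega> \<in> space M. point_count (X \<omega>) A = of_nat k}
               = exp (- measure \<mu> A) * measure \<mu> A ^ k / fact k) \<and>
     (\<forall>(n::nat) A. (\<forall>i<n. A i \<in> sets \<mu>) \<longrightarrow> disjoint_family_on A {..<n} \<longrightarrow>
        prob_space.indep_vars M (\<lambda>_. borel) (\<lambda>i \<omega>. point_count (X \<omega>) (A i)) {..<n})"

definition unit_rate :: "(real \<times> real) measure" where
  "unit_rate = restrict_space lborel ({0..1} \<times> {0..})"

text \<open>Threshold curves live on \<open>[0,1)\<close>; values outside that interval are irrelevant everywhere
  below.  No left limit is required at \<open>1\<close>, so a curve may be unbounded there.\<close>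

definition threshold_curve :: "(real \<Rightarrow> real) \<Rightarrow> bool" where
  "threshold_curve f \<longleftrightarrow>
     (\<forall>t\<in>{0..<1}. 0 \<le> f t) \<and>
     mono_on {0..<1} f \<and>
     (\<forall>t\<in>{0..<1}. continuous (at_right t) f) \<and>
     (\<forall>t\<in>{0<..<1}. \<exists>l. (f \<longlongrightarrow> l) (at_left t))"

definition subgraph :: "(real \<Rightarrow> real) \<Rightarrow> (real \<times> real) set" where
  "subgraph f = {(t, x). 0 \<le> t \<and> t < 1 \<and> 0 \<le> x \<and> x \<le> f t}"

definition best_atom :: "(real \<times> real) set \<Rightarrow> real \<times> real" where
  "best_atom S = (ARG_MIN snd p. p \<in> S)"

definition stopping_point :: "(real \<Rightarrow> real) \<Rightarrow> (real \<times> real) set \<Rightarrow> real \<times> ereal" where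
  "stopping_point f S =
     (if S \<inter> subgraph f = {} then (1, \<infinity>)
      else map_prod id ereal (ARG_MIN fst p. p \<in> S \<inter> subgraph f))"

text \<open>The two minimisers exist and are unique only almost surely.  Taking the completion makes
  their arbitrary values on the exceptional null set immaterial (with respect to \<open>M\<close> itself the
  event could fail to be measurable, and \<open>measure\<close> would then return \<open>0\<close>).\<close>

definition success_prob ::
    "'a measure \<Rightarrow> ('a \<Rightarrow> (real \<times> real) set) \<Rightarrow> (real \<Rightarrow> real) \<Rightarrow> real" where
  "success_prob M X f =
     measure (completion M)
       {\<omega> \<in> space M. fst (stopping_point f (X \<omega>)) = fst (best_atom (X \<omega>))}"

definition optimal_threshold_curve ::
    "'a measure \<Rightarrow> ('a \<Rightarrow> (real \<times> real) set) \<Rightarrow> (real \<Rightarrow> real) \<Rightarrow> bool" where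
  "optimal_threshold_curve M X f \<longleftrightarrow>
     threshold_curve f \<and>
     success_prob M X f = (SUP h\<in>{h. threshold_curve h}. success_prob M X h)"

definition threshold_integral :: "(real \<Rightarrow> real) \<Rightarrow> real \<Rightarrow> real" where
  "threshold_integral f t = (LBINT s:{0..t}. f s)"

definition threshold_inverse :: "(real \<Rightarrow> real) \<Rightarrow> real \<Rightarrow> real" where
  "threshold_inverse f x =
     (if {t \<in> {0..<1}. f t < x} = {} then 0 else Sup {t \<in> {0..<1}. f t < x})"

definition threshold_inverse_integral :: "(real \<Rightarrow> real) \<Rightarrow> real \<Rightarrow> real" where
  "threshold_inverse_integral f x = (LBINT z:{0..x}. threshold_inverse f z)"

text \<open>Meaningful for \<open>0 \<le> t < 1\<close> and \<open>0 \<le> x \<le> f t\<close>, the only arguments used below.\<close>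

definition winning_rate :: "(real \<Rightarrow> real) \<Rightarrow> real \<Rightarrow> real \<Rightarrow> real" where
  "winning_rate f t x =
     exp (- threshold_integral f t) *
     exp (- threshold_inverse_integral f x - x * (1 - t))"

definition temporal_winning_rate :: "(real \<Rightarrow> real) \<Rightarrow> real \<Rightarrow> real" where
  "temporal_winning_rate f t = (LBINT x:{0..f t}. winning_rate f t x)"

end

theory Submission
  imports Defs
begin

text \<open>
  Write \<open>A t x\<close> for the area of \<open>{(s, y). s < t \<and> y \<le> f s} \<union> {y < x}\<close>, so that \<open>A t x = x + \<integral>\<^sub>0\<^sup>t (f s - x)\<^sup>+ ds\<close>.
  A discretisation of the Poisson process shows that \<open>J(f) = \<integral> w\<close>, where
  \<open>w t = \<integral>\<^sub>0\<^sup>f\<^sup>t exp (- A t x) dx\<close>. With \<open>v t = \<integral>\<^sub>0\<^sup>f\<^sup>t x exp (- A t x) dx\<close>, integrating \<open>\<partial>A/\<partial>t = (f - x)\<^sup>+\<close> gives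
  \<open>w t + exp (- f t) = 1 - \<integral>\<^sub>0\<^sup>t f w + \<integral>\<^sub>0\<^sup>t v\<close>, and the claim \<open>\<integral> f w = 1\<close> becomes
  \<open>lim (w t + exp (- f t)) = \<integral> v\<close> as \<open>t \<longlongrightarrow> 1\<close>.

  The optimal success probability is the same on every time horizon, by scaling time and score.
  Cutting an optimal curve off at time \<open>1 - \<epsilon>\<close> loses \<open>\<integral> w\<close> over the last \<open>\<epsilon>\<close> time units and
  gains \<open>\<epsilon> \<integral> v\<close> to first order, as atoms of that period no longer beat the chosen one; optimality gives
  \<open>\<integral> f w \<le> 1\<close>. Prolonging it to time \<open>1 + \<epsilon>\<close> by a constant \<open>D\<close> gives the converse.
  As \<open>f\<close> may be unbounded, the constant has to replace \<open>f\<close> already from time \<open>1 - \<epsilon>\<close> on, and it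
  must satisfy \<open>D \<longlongrightarrow> \<infinity>\<close> and \<open>\<epsilon> D \<longlongrightarrow> 0\<close>.\<close>

subsection \<open>Integration on intervals\<close>

lemma set_integrable_bounded:
  fixes g :: "'a \<Rightarrow> real"
  assumes "g \<in> borel_measurable M" "A \<in> sets M" "emeasure M A < \<infinity>" "\<And>x. x \<in> A \<Longrightarrow> \<bar>g x\<bar> \<le> B"
  shows "set_integrable M A g"
  unfolding set_integrable_def
  using assms by (intro integrableI_bounded_set[where A=A and B=B]) (auto simp: indicator_def)

lemma set_integral_Icc_add:
  fixes g :: "real \<Rightarrow> real"
  assumes "set_integrable lborel {a..c} g" "a \<le> b" "b \<le> c"
  shows "(LBINT r:{a..c}. g r) = (LBINT r:{a..b}. g r) + (LBINT r:{b..c}. g r)"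
proof -
  have "(LBINT r:{a..b} \<union> {b..c}. g r) = (LBINT r:{a..b}. g r) + (LBINT r:{b..c}. g r)"
    using assms AE_lborel_singleton[of b]
    by (intro set_integral_Un_AE) (auto elim!: eventually_mono set_integrable_subset)
  moreover have "{a..b} \<union> {b..c} = {a..c}" using assms by auto
  ultimately show ?thesis by simp
qed

lemma set_integral_Ico_add:
  fixes g :: "real \<Rightarrow> real"
  assumes "set_integrable lborel {a..<c} g" "a \<le> b" "b \<le> c"
  shows "(LBINT r:{a..<c}. g r) = (LBINT r:{a..<b}. g r) + (LBINT r:{b..<c}. g r)"
proof -
  have "(LBINT r:{a..<b} \<union> {b..<c}. g r) = (LBINT r:{a..<b}. g r) + (LBINT r:{b..<c}. g r)"
    using assms by (intro set_integral_Un) (auto elim!: set_integrable_subset)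
  moreover have "{a..<b} \<union> {b..<c} = {a..<c}" using assms by auto
  ultimately show ?thesis by simp
qed

lemma set_integral_Icc_eq_Ico:
  fixes g :: "real \<Rightarrow> real"
  shows "(LBINT r:{a..b}. g r) = (LBINT r:{a..<b}. g r)"
proof -
  have "(LBINT r. indicator {a..b} r *\<^sub>R g r) = (LBINT r. indicator {a..<b} r *\<^sub>R g r)"
    by (rule integral_discrete_difference[where X="{b}"]) (auto simp: indicator_def)
  then show ?thesis by (simp add: set_lebesgue_integral_def)
qed

lemma set_integral_nonneg:
  fixes g :: "'a \<Rightarrow> real"
  assumes "\<And>x. x \<in> A \<Longrightarrow> 0 \<le> g x"
  shows "0 \<le> (LINT x:A|M. g x)"
  unfolding set_lebesgue_integral_def using assms
  by (intro Bochner_Integration.integral_nonneg) (auto simp: indicator_def)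

lemma set_integral_exp_Icc:
  fixes c :: real
  assumes "a \<le> c"
  shows "(LBINT x:{a..c}. exp (- x)) = exp (- a) - exp (- c)"
    and "set_integrable lborel {a..c} (\<lambda>x. exp (- x))"
proof -
  have "has_bochner_integral lborel (\<lambda>x. exp (- x) * indicator {a..c} x) (- exp (- c) - (- exp (- a)))"
    using assms by (intro has_bochner_integral_FTC_Icc_real) (auto intro!: derivative_eq_intros)
  then show "(LBINT x:{a..c}. exp (- x)) = exp (- a) - exp (- c)"
    "set_integrable lborel {a..c} (\<lambda>x. exp (- x))"
    by (auto simp: set_lebesgue_integral_def set_integrable_def has_bochner_integral_iff mult.commute)
qed

lemma set_integral_mult_exp_Icc:
  fixes c :: real
  assumes "0 \<le> c"
  shows "(LBINT x:{0..c}. x * exp (- x)) \<le> 1"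
    and "set_integrable lborel {0..c} (\<lambda>x. x * exp (- x))"
proof -
  have "has_bochner_integral lborel (\<lambda>x. (x * exp (- x)) * indicator {0..c} x)
      (- (1 + c) * exp (- c) - (- (1 + 0) * exp (- 0)))"
    using assms
    by (intro has_bochner_integral_FTC_Icc_real) (auto intro!: derivative_eq_intros simp: algebra_simps)
  then show "(LBINT x:{0..c}. x * exp (- x)) \<le> 1" "set_integrable lborel {0..c} (\<lambda>x. x * exp (- x))"
    using assms mult_nonneg_nonpos[of "exp (- c)" "- 1 - c"]
    by (auto simp: set_lebesgue_integral_def set_integrable_def has_bochner_integral_iff mult.commute)
qed

text \<open>The integrated derivative rule for exp (- Q), where \<open>q\<close> is only bounded and
  measurable: its primitive \<open>Q\<close> is Lipschitz but need not be differentiable everywhere,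
  so the fundamental theorem for continuous integrands does not apply. Instead the left side plus
  the integral on the right is shown to have increments of second order, hence to be
  constant.\<close>

lemma exp_minus_integral:
  fixes q :: "real \<Rightarrow> real"
  assumes [measurable]: "q \<in> borel_measurable borel"
    and q: "\<And>s. 0 \<le> s \<Longrightarrow> s \<le> T \<Longrightarrow> 0 \<le> q s \<and> q s \<le> B" and t: "0 \<le> t" "t \<le> T"
  shows "exp (- (LBINT s:{0..t}. q s)) = 1 - (LBINT s:{0..t}. q s * exp (- (LBINT r:{0..s}. q r)))"
proof -
  define Q where "Q s = (LBINT r:{0..s}. q r)" for s
  have B: "B \<ge> 0" using q[of 0] t by auto
  have Qm [measurable]: "Q \<in> borel_measurable borel"
  proof -
    have "Q = (\<lambda>s. LBINT r. (if 0 \<le> r \<and> r \<le> s then q r else 0))"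
      unfolding Q_def set_lebesgue_integral_def by (intro ext Bochner_Integration.integral_cong) auto
    then show ?thesis by simp
  qed
  have qi: "set_integrable lborel {a..b} q" if "0 \<le> a" "b \<le> T" for a b
    using that q B by (intro set_integrable_bounded[where B=B]) (auto simp: emeasure_lborel_Icc_eq)
  have Qdiff: "Q b - Q a = (LBINT r:{a..b}. q r)" if "0 \<le> a" "a \<le> b" "b \<le> T" for a b
    using set_integral_Icc_add[of 0 b q a] qi[of 0 b] that by (simp add: Q_def)
  have Qb: "0 \<le> Q b - Q a \<and> Q b - Q a \<le> B * (b - a)" if "0 \<le> a" "a \<le> b" "b \<le> T" for a b
  proof -
    have "0 \<le> (LBINT r:{a..b}. q r)"
      using that q unfolding set_lebesgue_integral_def
      by (intro integral_nonneg_AE) (auto simp: indicator_def)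
    moreover have "(LBINT r:{a..b}. q r) \<le> (LBINT r:{a..b}. B)"
      using that q qi by (intro set_integral_mono) (auto simp: set_integrable_def)
    moreover have "(LBINT r:{a..b}. B) = B * (b - a)"
      using that by (subst set_integral_const) auto
    ultimately show ?thesis using Qdiff[OF that] by simp
  qed
  have Q0: "0 \<le> Q a" if "0 \<le> a" "a \<le> T" for a
    using that q unfolding Q_def set_lebesgue_integral_def
    by (intro integral_nonneg_AE) (auto simp: indicator_def)
  define p where "p s = q s * exp (- Q s)" for s
  have pm [measurable]: "p \<in> borel_measurable borel" unfolding p_def by simp
  have pb: "0 \<le> p s \<and> p s \<le> B" if "0 \<le> s" "s \<le> T" for s
    using q[of s] Q0[of s] that mult_mono[of "q s" B "exp (- Q s)" 1] by (auto simp: p_def)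
  have pint: "set_integrable lborel {a..b} p" if "0 \<le> a" "b \<le> T" for a b
    using that pb B by (intro set_integrable_bounded[where B=B]) (auto simp: emeasure_lborel_Icc_eq)
  define D where "D s = exp (- Q s) + (LBINT r:{0..s}. p r)" for s
  \<comment> \<open>\<open>Q\<close> is nondecreasing, so the integral of \<open>p\<close> over
    [a, b] lies between exp (- Q b) * \<Delta> and exp (- Q a) * \<Delta>, while the exponential
    falls by exp (- Q a) * (1 - exp (- \<Delta>)). The first-order terms cancel, and \<Delta> is at
    most B * (b - a).\<close>
  have Dq: "\<bar>D b - D a\<bar> \<le> 2 * B\<^sup>2 * (b - a)\<^sup>2" if ab: "0 \<le> a" "a \<le> b" "b \<le> T" for a b
  proof -
    define \<Delta> where "\<Delta> = Q b - Q a"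
    have \<Delta>: "0 \<le> \<Delta>" "\<Delta> \<le> B * (b - a)" using Qb[OF ab] by (auto simp: \<Delta>_def)
    have 1: "D b - D a = exp (- Q b) - exp (- Q a) + (LBINT r:{a..b}. p r)"
      using set_integral_Icc_add[of 0 b p a] pint[of 0 b] ab by (simp add: D_def)
    have ub: "(LBINT r:{a..b}. p r) \<le> exp (- Q a) * \<Delta>"
    proof -
      have "(LBINT r:{a..b}. p r) \<le> (LBINT r:{a..b}. exp (- Q a) * q r)"
        using that q Qb[of a] by (intro set_integral_mono pint set_integrable_mult_right qi)
          (auto simp: p_def mult.commute intro!: mult_left_mono)
      then show ?thesis using Qdiff[OF ab] by (simp add: \<Delta>_def)
    qed
    have lb: "exp (- Q b) * \<Delta> \<le> (LBINT r:{a..b}. p r)"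
    proof -
      have "(LBINT r:{a..b}. exp (- Q b) * q r) \<le> (LBINT r:{a..b}. p r)"
        using that q Qb[of _ b] by (intro set_integral_mono pint set_integrable_mult_right qi)
          (auto simp: p_def mult.commute intro!: mult_left_mono)
      then show ?thesis using Qdiff[OF ab] by (simp add: \<Delta>_def)
    qed
    have e1: "exp (- Q b) = exp (- Q a) * exp (- \<Delta>)" by (simp add: \<Delta>_def flip: exp_add)
    have ea: "0 < exp (- Q a)" "exp (- Q a) \<le> 1" using Q0[of a] that by auto
    have x1: "1 - \<Delta> \<le> exp (- \<Delta>)" using exp_ge_add_one_self[of "-\<Delta>"] by simp
    have "exp \<Delta> * exp (-\<Delta>) = 1" by (simp flip: exp_add)
    then have x2: "exp (- \<Delta>) * (1 + \<Delta>) \<le> 1"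
      using exp_ge_add_one_self[of \<Delta>] by (metis exp_ge_zero mult.commute mult_left_mono)
    have x3: "exp (- \<Delta>) - 1 + \<Delta> \<le> \<Delta>\<^sup>2"
    proof -
      have "exp (- \<Delta>) \<le> 1 / (1 + \<Delta>)" using x2 \<Delta> by (simp add: field_simps)
      also have "\<dots> \<le> 1 - \<Delta> + \<Delta>\<^sup>2" using \<Delta> by (simp add: field_simps power2_eq_square)
      finally show ?thesis by simp
    qed
    have "D b - D a \<le> exp (- Q a) * (exp (- \<Delta>) - 1 + \<Delta>)"
      using 1 ub e1 by (simp add: algebra_simps)
    also have "\<dots> \<le> 1 * \<Delta>\<^sup>2" using ea x1 x3 by (intro mult_mono) auto
    finally have u: "D b - D a \<le> \<Delta>\<^sup>2" by simp
    have "D b - D a \<ge> exp (- Q a) * (exp (- \<Delta>) * (1 + \<Delta>) - 1)"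
      using 1 lb e1 by (simp add: algebra_simps)
    moreover have "exp (- \<Delta>) * (1 + \<Delta>) - 1 \<ge> - \<Delta>\<^sup>2"
    proof -
      have "(1 - \<Delta>) * (1 + \<Delta>) \<le> exp (- \<Delta>) * (1 + \<Delta>)" using x1 \<Delta> by (intro mult_right_mono) auto
      then show ?thesis by (simp add: algebra_simps power2_eq_square)
    qed
    moreover have "exp (- Q a) * (- \<Delta>\<^sup>2) \<ge> - \<Delta>\<^sup>2"
      using ea by (simp add: mult_left_le_one_le)
    ultimately have l: "D b - D a \<ge> - \<Delta>\<^sup>2"
      by (smt (verit, ccfv_SIG) ea(1) mult_left_mono)
    have "\<Delta>\<^sup>2 \<le> (B * (b - a))\<^sup>2" using \<Delta> by (intro power_mono) auto
    moreover have "0 \<le> (B * (b - a))\<^sup>2" by simp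
    ultimately show ?thesis using u l by (auto simp: abs_if power_mult_distrib)
  qed
  have Dq': "\<bar>D b - D a\<bar> \<le> 2 * B\<^sup>2 * (b - a)\<^sup>2" if "a \<in> {0..T}" "b \<in> {0..T}" for a b
    using Dq[of a b] Dq[of b a] that by (cases "a \<le> b") (auto simp: abs_minus_commute power2_commute)
  have "D t = D 0" if "0 < t"
  proof (rule DERIV_isconst_end[OF that])
    fix z assume "0 < z" "z < t"
    then have z: "z \<in> {0<..<T}" using t by auto
    have "((\<lambda>y. (D y - D z) / (y - z)) \<longlongrightarrow> 0) (at z)"
    proof (rule Lim_null_comparison)
      show "\<forall>\<^sub>F y in at z. norm ((D y - D z) / (y - z)) \<le> 2 * B\<^sup>2 * \<bar>y - z\<bar>"
      proof -
        have "\<forall>\<^sub>F y in at z. y \<in> {0<..<T}"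
          using z by (intro eventually_at_in_open') auto
        then show ?thesis
        proof eventually_elim
          case (elim y)
          show ?case
          proof (cases "y = z")
            case False
            have "\<bar>D y - D z\<bar> \<le> 2 * B\<^sup>2 * \<bar>y - z\<bar> * \<bar>y - z\<bar>"
              using Dq'[of z y] z elim by (simp add: power2_eq_square mult.assoc)
            then show ?thesis using False by (simp add: divide_simps)
          qed simp
        qed
      qed
      show "((\<lambda>y. 2 * B\<^sup>2 * \<bar>y - z\<bar>) \<longlongrightarrow> 0) (at z)"
        by (auto intro!: tendsto_eq_intros)
    qed
    then show "(D has_real_derivative 0) (at z)" by (simp add: has_field_derivative_iff)
  next
    have "continuous_on {0..T} D"
      unfolding continuous_on_def
    proof
      fix z assume z: "z \<in> {0..T}"
      show "(D \<longlongrightarrow> D z) (at z within {0..T})"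
      proof (subst LIM_zero_iff[symmetric], rule Lim_null_comparison)
        show "\<forall>\<^sub>F y in at z within {0..T}. norm (D y - D z) \<le> 2 * B\<^sup>2 * (y - z)\<^sup>2"
          using Dq' z by (auto simp: eventually_at_filter)
        show "((\<lambda>y. 2 * B\<^sup>2 * (y - z)\<^sup>2) \<longlongrightarrow> 0) (at z within {0..T})"
          by (auto intro!: tendsto_eq_intros)
      qed
    qed
    then show "continuous_on {0..t} D" using t by (auto elim: continuous_on_subset)
  qed
  then have "D t = D 0" using t by (cases "t = 0") auto
  \<comment> \<open>Evaluates \<open>D 0\<close> to 1: both integrals in it run over a single
    point.\<close>
  moreover have z0: "(LBINT r:{0..0::real}. h r) = 0" for h :: "real \<Rightarrow> real"
  proof -
    have "(\<lambda>x. indicator {0..0} x *\<^sub>R h x) = (\<lambda>x. indicator {0} x * h 0)" by (auto simp: indicator_def)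
    then show ?thesis unfolding set_lebesgue_integral_def by simp
  qed
  ultimately show ?thesis by (simp add: D_def p_def Q_def)
qed

subsection \<open>Areas and winning rates\<close>

text \<open>For an atom \<open>(t, x)\<close> below the curve on the time horizon \<open>[0, L]\<close>, the area \<open>L * x + excess f t x\<close> has to
  be free of atoms; \<open>survival\<close> is the probability of this.\<close>

definition excess :: "(real \<Rightarrow> real) \<Rightarrow> real \<Rightarrow> real \<Rightarrow> real" where
  "excess f t x = (LBINT s:{0..t}. max 0 (f s - x))"

definition survival :: "real \<Rightarrow> (real \<Rightarrow> real) \<Rightarrow> real \<Rightarrow> real \<Rightarrow> real" where
  "survival L f t x = exp (- (L * x + excess f t x))"

definition rate :: "real \<Rightarrow> (real \<Rightarrow> real) \<Rightarrow> real \<Rightarrow> real" where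
  "rate L f t = (LBINT x:{0..f t}. survival L f t x)"

definition total_rate :: "(real \<Rightarrow> real) \<Rightarrow> real" where
  "total_rate f = (LBINT t:{0..<1}. rate 1 f t)"

text \<open>Up to sign the derivative of \<open>rate L f t\<close> in \<open>L\<close> at 1: the
  first-order effect of a change of horizon while the curve is kept.\<close>

definition moment :: "(real \<Rightarrow> real) \<Rightarrow> real \<Rightarrow> real" where
  "moment f t = (LBINT x:{0..f t}. x * survival 1 f t x)"

lemma excess_nonneg: "0 \<le> excess f t x"
  unfolding excess_def by (intro set_integral_nonneg) auto

lemma survival_pos: "0 < survival L f t x"
  by (simp add: survival_def)

lemma survival_le: "survival L f t x \<le> exp (- (L * x))"
  using excess_nonneg[of f t x] by (simp add: survival_def)

lemma survival_le_1: "0 \<le> L * x \<Longrightarrow> survival L f t x \<le> 1"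
  using excess_nonneg[of f t x] by (simp add: survival_def)

lemma survival_1: "survival 1 f t x = exp (- x) * exp (- excess f t x)"
  by (simp add: survival_def flip: exp_add)

lemma rate_nonneg: "0 \<le> rate L f t"
  unfolding rate_def by (intro set_integral_nonneg) (simp add: survival_pos less_imp_le)

lemma moment_nonneg: "0 \<le> moment f t"
  unfolding moment_def by (intro set_integral_nonneg) (simp add: survival_pos less_imp_le)

lemma measurable_excess [measurable]:
  assumes [measurable]: "f \<in> borel_measurable borel"
  shows "case_prod (excess f) \<in> borel_measurable (borel \<Otimes>\<^sub>M borel)"
proof -
  have "case_prod (excess f) = (\<lambda>p. LBINT s. (if 0 \<le> s \<and> s \<le> fst p then max 0 (f s - snd p) else 0))"
    unfolding excess_def set_lebesgue_integral_def
    by (intro ext) (auto simp: case_prod_unfold intro!: Bochner_Integration.integral_cong)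
  then show ?thesis by simp
qed

lemma measurable_survival [measurable]:
  assumes [measurable]: "f \<in> borel_measurable borel"
  shows "case_prod (survival L f) \<in> borel_measurable (borel \<Otimes>\<^sub>M borel)"
proof -
  have "case_prod (survival L f) = (\<lambda>p. exp (- (L * snd p + case_prod (excess f) p)))"
    by (auto simp: survival_def)
  then show ?thesis by simp
qed

lemma survival_measurable1 [measurable]:
  assumes [measurable]: "f \<in> borel_measurable borel"
  shows "survival L f t \<in> borel_measurable borel"
  using measurable_Pair2[OF measurable_survival[OF assms], of t] by simp

lemma measurable_rate [measurable]:
  assumes [measurable]: "f \<in> borel_measurable borel"
  shows "rate L f \<in> borel_measurable borel"
proof -
  have "rate L f = (\<lambda>t. LBINT x. (if 0 \<le> x \<and> x \<le> f t then case_prod (survival L f) (t, x) else 0))"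
    unfolding rate_def set_lebesgue_integral_def
    by (intro ext) (auto intro!: Bochner_Integration.integral_cong)
  then show ?thesis by simp
qed

lemma measurable_moment [measurable]:
  assumes [measurable]: "f \<in> borel_measurable borel"
  shows "moment f \<in> borel_measurable borel"
proof -
  have "moment f = (\<lambda>t. LBINT x. (if 0 \<le> x \<and> x \<le> f t then x * case_prod (survival 1 f) (t, x) else 0))"
    unfolding moment_def set_lebesgue_integral_def
    by (intro ext) (auto intro!: Bochner_Integration.integral_cong)
  then show ?thesis by simp
qed

lemma set_integrable_survival:
  assumes "f \<in> borel_measurable borel" "0 \<le> L"
  shows "set_integrable lborel {0..c} (survival L f t)"
proof (rule set_integrable_bounded[where B=1])
  fix x assume "x \<in> {0..c}"
  then show "\<bar>survival L f t x\<bar> \<le> 1"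
    using survival_le_1[of L x f t] survival_pos[of L f t x] assms by simp
qed (use assms in \<open>auto simp: emeasure_lborel_Icc_eq\<close>)

lemma set_integrable_moment:
  assumes "f \<in> borel_measurable borel"
  shows "set_integrable lborel {0..c} (\<lambda>x. x * survival 1 f t x)"
proof (rule set_integrable_bounded[where B="max 0 c"])
  fix x assume x: "x \<in> {0..c}"
  then show "\<bar>x * survival 1 f t x\<bar> \<le> max 0 c"
    using survival_le_1[of 1 x f t] survival_pos[of 1 f t x] mult_left_le[of "survival 1 f t x" x]
    by (simp add: abs_mult)
qed (use assms in \<open>auto simp: emeasure_lborel_Icc_eq\<close>)

lemma rate_le:
  assumes "f \<in> borel_measurable borel" "0 \<le> f t"
  shows "rate 1 f t \<le> 1 - exp (- f t)"
proof -
  have "rate 1 f t \<le> (LBINT x:{0..f t}. exp (- x))"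
    unfolding rate_def using assms set_integral_exp_Icc survival_le[of 1 f t]
    by (intro set_integral_mono set_integrable_survival) auto
  then show ?thesis using set_integral_exp_Icc(1)[OF assms(2)] by simp
qed

lemma moment_le:
  assumes "f \<in> borel_measurable borel" "0 \<le> f t"
  shows "moment f t \<le> 1"
proof -
  have "moment f t \<le> (LBINT x:{0..f t}. x * exp (- x))"
    unfolding moment_def using assms set_integral_mult_exp_Icc survival_le[of 1 f t]
    by (intro set_integral_mono set_integrable_moment) (auto intro!: mult_left_mono)
  then show ?thesis using set_integral_mult_exp_Icc(1)[OF assms(2)] by simp
qed

text \<open>Measurability and nonnegativity hold on the whole line, monotonicity only on [0, 1):
  this is what \<open>clip\<close> below provides for a threshold curve.\<close>

locale curve =
  fixes f :: "real \<Rightarrow> real"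
  assumes f_meas [measurable]: "f \<in> borel_measurable borel"
    and f_nonneg: "0 \<le> f t"
    and f_mono: "0 \<le> s \<Longrightarrow> s \<le> t \<Longrightarrow> t < 1 \<Longrightarrow> f s \<le> f t"
begin

lemma set_integrable_f_Icc:
  assumes "t < 1"
  shows "set_integrable lborel {0..t} (\<lambda>s. f s * rate 1 f s)"
    "set_integrable lborel {0..t} (moment f)"
    "set_integrable lborel {0..t} (\<lambda>s. max 0 (f s - x))"
proof -
  have "rate 1 f s \<le> 1" for s
    using rate_le[OF f_meas f_nonneg, of s] exp_gt_zero[of "- f s"] by linarith
  then have "\<bar>f s * rate 1 f s\<bar> \<le> f t" if "s \<in> {0..t}" for s
    using f_mono[of s t] f_nonneg[of s] rate_nonneg[of 1 f s] that assms mult_left_le[of "rate 1 f s" "f s"]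
    by (simp add: abs_mult)
  then show "set_integrable lborel {0..t} (\<lambda>s. f s * rate 1 f s)"
    by (intro set_integrable_bounded[where B="f t"]) (auto simp: emeasure_lborel_Icc_eq)
  show "set_integrable lborel {0..t} (moment f)"
    using moment_le[OF f_meas f_nonneg] moment_nonneg[of f]
    by (intro set_integrable_bounded[where B=1]) (auto simp: emeasure_lborel_Icc_eq)
  have "\<bar>max 0 (f s - x)\<bar> \<le> f t + \<bar>x\<bar>" if "s \<in> {0..t}" for s
    using f_mono[of s t] f_nonneg[of s] that assms by (auto simp: abs_if max_def)
  then show "set_integrable lborel {0..t} (\<lambda>s. max 0 (f s - x))"
    by (intro set_integrable_bounded[where B="f t + \<bar>x\<bar>"]) (auto simp: emeasure_lborel_Icc_eq)
qed

text \<open>This is \<open>exp_minus_integral\<close> for the integrand max 0 (f s - x), whose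
  integral is the excess, multiplied by exp (- x). Monotonicity supplies the bound
  \<open>f t\<close>.\<close>

lemma survival_eq:
  assumes t: "0 \<le> t" "t < 1" and x: "0 \<le> x"
  shows "survival 1 f t x = exp (- x) - (LBINT s:{0..t}. max 0 (f s - x) * survival 1 f s x)"
proof -
  have bound: "max 0 (f s - x) \<le> f t" if "0 \<le> s" "s \<le> t" for s
    using f_mono[OF that t(2)] f_nonneg[of t] x by simp
  have "exp (- excess f t x) = 1 - (LBINT s:{0..t}. max 0 (f s - x) * exp (- excess f s x))"
    unfolding excess_def
    using t x bound
    by (intro exp_minus_integral[where B="f t" and T=t]) (auto simp: f_nonneg)
  then have "exp (- x) * exp (- excess f t x) =
      exp (- x) - exp (- x) * (LBINT s:{0..t}. max 0 (f s - x) * exp (- excess f s x))"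
    by (simp add: right_diff_distrib)
  also have "exp (- x) * (LBINT s:{0..t}. max 0 (f s - x) * exp (- excess f s x)) =
     (LBINT s:{0..t}. exp (- x) * (max 0 (f s - x) * exp (- excess f s x)))"
    by (rule set_integral_mult_right[symmetric])
  also have "(\<lambda>s. exp (- x) * (max 0 (f s - x) * exp (- excess f s x))) = (\<lambda>s. max 0 (f s - x) * survival 1 f s x)"
    unfolding survival_1 by (simp only: mult_ac)
  finally show ?thesis by (simp only: survival_1)
qed

text \<open>Integrate \<open>survival_eq\<close> over x in [0, f t] and exchange the integrals.
  Against \<open>survival\<close>, the factor max 0 (f s - x) integrates to f s * rate - moment, and
  exp (- x) contributes 1 - exp (- f t).\<close>

lemma rate_plus_exp:
  assumes t: "0 \<le> t" "t < 1"
  shows "rate 1 f t + exp (- f t) = 1 - (LBINT s:{0..t}. f s * rate 1 f s) + (LBINT s:{0..t}. moment f s)"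
proof -
  define g where "g x s = indicator {0..f t} x * indicator {0..t} s * (max 0 (f s - x) * survival 1 f s x)" for x s :: real
  have gm: "case_prod g \<in> borel_measurable (borel \<Otimes>\<^sub>M borel)"
  proof -
    have "case_prod g = (\<lambda>p. indicator {0..f t} (fst p) * indicator {0..t} (snd p) * (max 0 (f (snd p) - fst p) * case_prod (survival 1 f) (snd p, fst p)))"
      by (auto simp: g_def)
    then show ?thesis by simp
  qed
  have gi: "integrable (lborel \<Otimes>\<^sub>M lborel) (case_prod g)"
  proof (rule integrableI_bounded_set[where A="{0..f t} \<times> {0..t}" and B="f t"])
    show "emeasure (lborel \<Otimes>\<^sub>M lborel) ({0..f t} \<times> {0..t}) < \<infinity>"
      by (subst lborel.emeasure_pair_measure_Times) (auto simp: emeasure_lborel_Icc_eq ennreal_mult_less_top)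
    have "norm (g x s) \<le> f t" if "x \<in> {0..f t}" "s \<in> {0..t}" for x s
    proof -
      have "survival 1 f s x \<le> 1" using survival_le_1[of 1 x f s] that by auto
      moreover have "max 0 (f s - x) \<le> f t" using f_mono[of s t] f_nonneg[of t] that t by auto
      ultimately have "max 0 (f s - x) * survival 1 f s x \<le> f t * 1"
        using survival_pos[of 1 f s x] by (intro mult_mono) (auto intro: f_nonneg)
      then show ?thesis using survival_pos[of 1 f s x] that by (simp add: g_def abs_mult)
    qed
    then show "AE p in lborel \<Otimes>\<^sub>M lborel. p \<in> {0..f t} \<times> {0..t} \<longrightarrow> norm (case_prod g p) \<le> f t"
      by (intro AE_I2) auto
    show "AE p in lborel \<Otimes>\<^sub>M lborel. p \<notin> {0..f t} \<times> {0..t} \<longrightarrow> case_prod g p = 0"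
      by (intro AE_I2) (auto simp: g_def indicator_def)
  qed (use gm in auto)
  \<comment> \<open>The factor vanishes for x > f s, and f s \<le> f t, so the range [0, f t]
    shrinks to [0, f s].\<close>
  have inner: "(LBINT x:{0..f t}. max 0 (f s - x) * survival 1 f s x) = f s * rate 1 f s - moment f s"
    if s: "s \<in> {0..t}" for s
  proof -
    have "f s \<le> f t" using f_mono s t by auto
    then have "(LBINT x:{0..f t}. max 0 (f s - x) * survival 1 f s x) =
        (LBINT x:{0..f s}. f s * survival 1 f s x - x * survival 1 f s x)"
      unfolding set_lebesgue_integral_def
      by (intro Bochner_Integration.integral_cong) (auto simp: indicator_def algebra_simps)
    also have "\<dots> = (LBINT x:{0..f s}. f s * survival 1 f s x) - (LBINT x:{0..f s}. x * survival 1 f s x)"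
      by (intro set_integral_diff set_integrable_moment set_integrable_mult_right set_integrable_survival) auto
    finally show ?thesis by (simp add: rate_def moment_def)
  qed
  have sec: "(LBINT x:{0..f t}. (LBINT s:{0..t}. max 0 (f s - x) * survival 1 f s x)) =
      (LBINT x. LBINT s. g x s)"
    unfolding set_lebesgue_integral_def g_def
    by (intro Bochner_Integration.integral_cong refl) (simp add: mult.assoc)
  have seci: "set_integrable lborel {0..f t} (\<lambda>x. LBINT s:{0..t}. max 0 (f s - x) * survival 1 f s x)"
  proof -
    have "integrable lborel (\<lambda>x. LBINT s. g x s)"
      using lborel_pair.integrable_fst'[OF gi] by simp
    also have "(\<lambda>x. LBINT s. g x s) = (\<lambda>x. indicator {0..f t} x *\<^sub>R (LBINT s:{0..t}. max 0 (f s - x) * survival 1 f s x))"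
      unfolding set_lebesgue_integral_def g_def by (simp add: mult.assoc)
    finally show ?thesis by (simp add: set_integrable_def)
  qed
  have "(LBINT x. LBINT s. g x s) = (LBINT s. LBINT x. g x s)"
    using lborel_pair.Fubini_integral[OF gi] by simp
  also have "\<dots> = (LBINT s:{0..t}. (LBINT x:{0..f t}. max 0 (f s - x) * survival 1 f s x))"
    unfolding set_lebesgue_integral_def g_def
    by (intro Bochner_Integration.integral_cong refl) (simp add: mult.assoc mult.left_commute)
  also have "\<dots> = (LBINT s:{0..t}. f s * rate 1 f s - moment f s)"
    using inner by (intro set_lebesgue_integral_cong) auto
  also have "\<dots> = (LBINT s:{0..t}. f s * rate 1 f s) - (LBINT s:{0..t}. moment f s)"
    using t by (intro set_integral_diff set_integrable_f_Icc) auto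
  finally have fub: "(LBINT x. LBINT s. g x s) = \<dots>" .
  have "rate 1 f t = (LBINT x:{0..f t}. exp (- x) - (LBINT s:{0..t}. max 0 (f s - x) * survival 1 f s x))"
    unfolding rate_def using survival_eq[OF t] by (intro set_lebesgue_integral_cong) auto
  also have "\<dots> = (LBINT x:{0..f t}. exp (- x)) - (LBINT x:{0..f t}. (LBINT s:{0..t}. max 0 (f s - x) * survival 1 f s x))"
    using seci set_integral_exp_Icc(2)[OF f_nonneg] by (intro set_integral_diff) auto
  finally show ?thesis using fub sec set_integral_exp_Icc(1)[OF f_nonneg] by simp
qed

end

lemma rate_le_self:
  assumes "f \<in> borel_measurable borel" "0 \<le> f t" "0 \<le> L"
  shows "rate L f t \<le> f t"
proof -
  have "rate L f t \<le> (LBINT x:{0..f t}. 1)"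
    unfolding rate_def using assms
    by (intro set_integral_mono set_integrable_survival)
      (auto intro!: survival_le_1 set_integrable_bounded[where B=1] simp: emeasure_lborel_Icc_eq)
  then show ?thesis using assms by (subst (asm) set_integral_const) auto
qed

section \<open>Comparison with shorter and longer time horizons\<close>

context curve
begin

lemma set_integrable_rate:
  "A \<in> sets borel \<Longrightarrow> A \<subseteq> {0..<1} \<Longrightarrow> set_integrable lborel A (rate 1 f)"
proof -
  have "rate 1 f s \<le> 1" for s
    using rate_le[OF f_meas f_nonneg, of s] exp_gt_zero[of "- f s"] by linarith
  then have "set_integrable lborel {0..<1} (rate 1 f)"
    using rate_nonneg[of 1 f] by (intro set_integrable_bounded[where B=1]) (auto simp: emeasure_lborel_Ico)
  then show "set_integrable lborel A (rate 1 f)" if "A \<in> sets borel" "A \<subseteq> {0..<1}"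
    using that by (auto elim: set_integrable_subset)
qed

lemma set_integrable_moment_Ico:
  "A \<in> sets borel \<Longrightarrow> A \<subseteq> {0..<1} \<Longrightarrow> set_integrable lborel A (moment f)"
proof -
  have "set_integrable lborel {0..<1} (moment f)"
    using moment_le[OF f_meas f_nonneg] moment_nonneg[of f]
    by (intro set_integrable_bounded[where B=1]) (auto simp: emeasure_lborel_Ico)
  then show "set_integrable lborel A (moment f)" if "A \<in> sets borel" "A \<subseteq> {0..<1}"
    using that by (auto elim: set_integrable_subset)
qed

lemma excess_eq_0:
  assumes "0 \<le> t" "t < 1" "f t \<le> x"
  shows "excess f t x = 0"
proof -
  have "excess f t x = (LBINT s:{0..t}. 0)"
    unfolding excess_def using assms f_mono[of _ t]
    by (intro set_lebesgue_integral_cong) fastforce+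
  then show ?thesis by simp
qed

text \<open>Above height \<open>f t\<close> the excess vanishes by monotonicity and
  \<open>survival\<close> is exp (- x). Thus rate + exp (- f t) is the limit of these integrals for
  growing D, which is how it enters \<open>longer_horizon\<close>.\<close>

lemma integral_survival:
  assumes t: "0 \<le> t" "t < 1" and D: "f t \<le> D"
  shows "(LBINT x:{0..D}. survival 1 f t x) = rate 1 f t + exp (- f t) - exp (- D)"
proof -
  have "(LBINT x:{0..D}. survival 1 f t x) = rate 1 f t + (LBINT x:{f t..D}. survival 1 f t x)"
    unfolding rate_def using D f_nonneg by (intro set_integral_Icc_add set_integrable_survival) auto
  also have "(LBINT x:{f t..D}. survival 1 f t x) = (LBINT x:{f t..D}. exp (- x))"
    using excess_eq_0[OF t] by (intro set_lebesgue_integral_cong) (auto simp: survival_def)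
  finally show ?thesis using set_integral_exp_Icc(1)[OF D] by simp
qed

text \<open>Compare with the curve cut off at time \<open>c < 1\<close> and rescaled to the whole time interval.\<close>

lemma shorter_horizon:
  assumes c: "0 < c" "c < 1" and le: "(LBINT t:{0..<c}. rate c f t) \<le> total_rate f"
  shows "(1 - c) * (LBINT t:{0..<c}. moment f t) \<le> (LBINT t:{c..<1}. rate 1 f t)"
proof -
  \<comment> \<open>Shortening the horizon multiplies \<open>survival\<close> by exp ((1 - c) * x),
    which is at least 1 + (1 - c) * x; the second term integrates to the moment.\<close>
  have pw: "rate 1 f t + (1 - c) * moment f t \<le> rate c f t" for t
  proof -
    have "rate 1 f t + (1 - c) * moment f t =
       (LBINT x:{0..f t}. survival 1 f t x + (1 - c) * (x * survival 1 f t x))"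
      unfolding rate_def moment_def
      by (subst set_integral_add) (auto intro!: set_integrable_moment set_integrable_survival set_integrable_mult_right)
    also have "\<dots> \<le> rate c f t"
      unfolding rate_def
    proof (intro set_integral_mono set_integral_add set_integrable_moment set_integrable_survival set_integrable_mult_right)
      fix x
      have "(1 + (1 - c) * x) * survival 1 f t x \<le> exp ((1 - c) * x) * survival 1 f t x"
        using exp_ge_add_one_self[of "(1 - c) * x"] survival_pos[of 1 f t x] by (intro mult_right_mono) auto
      also have "\<dots> = survival c f t x" by (simp add: survival_def algebra_simps flip: exp_add)
      finally show "survival 1 f t x + (1 - c) * (x * survival 1 f t x) \<le> survival c f t x"
        by (simp add: algebra_simps)
    qed (use c in auto)
    finally show ?thesis .
  qed
  have int: "set_integrable lborel {0..<c} (rate c f)"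
  proof (rule set_integrable_bounded[where B="f c"])
    fix t assume "t \<in> {0..<c}"
    then show "\<bar>rate c f t\<bar> \<le> f c"
      using rate_le_self[OF f_meas f_nonneg, of c t] rate_nonneg[of c f t] f_mono[of t c] c by auto
  qed (use c in \<open>auto simp: emeasure_lborel_Ico\<close>)
  have "(LBINT t:{0..<c}. rate 1 f t) + (1 - c) * (LBINT t:{0..<c}. moment f t) =
     (LBINT t:{0..<c}. rate 1 f t + (1 - c) * moment f t)"
    using c by (subst set_integral_add) (auto intro!: set_integrable_rate set_integrable_moment_Ico set_integrable_mult_right)
  also have "\<dots> \<le> (LBINT t:{0..<c}. rate c f t)"
    using c int pw by (intro set_integral_mono set_integral_add set_integrable_rate set_integrable_moment_Ico set_integrable_mult_right) auto
  also have "\<dots> \<le> total_rate f" by (rule le)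
  also have "total_rate f = (LBINT t:{0..<c}. rate 1 f t) + (LBINT t:{c..<1}. rate 1 f t)"
    unfolding total_rate_def using c by (intro set_integral_Ico_add set_integrable_rate) auto
  finally show ?thesis by simp
qed

text \<open>The constant takes over before time \<open>1\<close> because \<open>f\<close> may be unbounded there.\<close>

definition prolong :: "real \<Rightarrow> real \<Rightarrow> real \<Rightarrow> real" where
  "prolong \<epsilon> D t = (if t < 1 - \<epsilon> then f t else D)"

lemma prolong_measurable [measurable]: "prolong \<epsilon> D \<in> borel_measurable borel"
  unfolding prolong_def by simp

text \<open>Before 1 - \<epsilon> the longer horizon costs at most \<epsilon> times the moment; over
  the last 2 * \<epsilon> time units the constant height wins at a rate bounded below. In the
  comparison with \<open>total_rate f\<close> the common part before 1 - \<epsilon> cancels.\<close>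

lemma longer_horizon:
  assumes e: "0 < \<epsilon>" "\<epsilon> < 1" and D: "f (1 - \<epsilon>) \<le> D"
    and le: "(LBINT t:{0..<1 + \<epsilon>}. rate (1 + \<epsilon>) (prolong \<epsilon> D) t) \<le> total_rate f"
  shows "2 * \<epsilon> * exp (- (2 * \<epsilon> * D)) * (rate 1 f (1 - \<epsilon>) + exp (- f (1 - \<epsilon>)) - exp (- D))
    \<le> (LBINT t:{1 - \<epsilon>..<1}. rate 1 f t) + \<epsilon> * (LBINT t:{0..<1}. moment f t)"
proof -
  define k where "k = prolong \<epsilon> D"
  define t0 where "t0 = 1 - \<epsilon>"
  have t0: "0 < t0" "t0 < 1" using e by (auto simp: t0_def)
  have km [measurable]: "k \<in> borel_measurable borel" by (simp add: k_def)
  have D0: "0 \<le> D" using D f_nonneg[of "1 - \<epsilon>"] by linarith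
  have kn: "0 \<le> k t" for t using D0 f_nonneg by (simp add: k_def prolong_def)
  have kD: "k t \<le> D" if "0 \<le> t" for t
    using D f_mono[of t "1 - \<epsilon>"] that e by (auto simp: k_def prolong_def)
  \<comment> \<open>The curves agree up to time t, so \<open>survival\<close> changes only by the
    factor exp (- \<epsilon> * x), which is at least 1 - \<epsilon> * x.\<close>
  have early: "rate 1 f t - \<epsilon> * moment f t \<le> rate (1 + \<epsilon>) k t" if t: "t \<in> {0..<t0}" for t
  proof -
    have kf: "k s = f s" if "s \<le> t" for s using that t by (auto simp: k_def prolong_def t0_def)
    have ex: "excess k t x = excess f t x" for x
      unfolding excess_def using kf by (intro set_lebesgue_integral_cong) auto
    have "rate 1 f t - \<epsilon> * moment f t =
       (LBINT x:{0..f t}. survival 1 f t x - \<epsilon> * (x * survival 1 f t x))"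
      unfolding rate_def moment_def
      by (subst set_integral_diff) (auto intro!: set_integrable_moment set_integrable_survival set_integrable_mult_right)
    also have "\<dots> \<le> (LBINT x:{0..f t}. survival (1 + \<epsilon>) k t x)"
    proof (intro set_integral_mono set_integral_diff set_integrable_moment set_integrable_survival set_integrable_mult_right)
      fix x
      have "(1 - \<epsilon> * x) * survival 1 f t x \<le> exp (- \<epsilon> * x) * survival 1 f t x"
        using exp_ge_add_one_self[of "- \<epsilon> * x"] survival_pos[of 1 f t x] by (intro mult_right_mono) auto
      also have "\<dots> = survival (1 + \<epsilon>) k t x" by (simp add: survival_def ex algebra_simps flip: exp_add)
      finally show "survival 1 f t x - \<epsilon> * (x * survival 1 f t x) \<le> survival (1 + \<epsilon>) k t x"
        by (simp add: algebra_simps)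
    qed (use e in auto)
    finally show ?thesis using kf[of t] by (simp add: rate_def)
  qed
  \<comment> \<open>The bound is uniform in t: \<open>survival\<close> at time t0 integrated up to
    height D, with the factor exp (- 2 * \<epsilon> * D) paying for the area added after t0 and by
    the longer horizon.\<close>
  have late: "exp (- (2 * \<epsilon> * D)) * (rate 1 f t0 + exp (- f t0) - exp (- D)) \<le> rate (1 + \<epsilon>) k t"
    if t: "t \<in> {t0..<1 + \<epsilon>}" for t
  proof -
    have kt: "k t = D" using t by (auto simp: k_def prolong_def t0_def)
    have "exp (- (2 * \<epsilon> * D)) * (rate 1 f t0 + exp (- f t0) - exp (- D)) =
      exp (- (2 * \<epsilon> * D)) * (LBINT x:{0..D}. survival 1 f t0 x)"
      using integral_survival[of t0 D] t0 D by (simp add: t0_def)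
    also have "\<dots> = (LBINT x:{0..D}. exp (- (2 * \<epsilon> * D)) * survival 1 f t0 x)" by simp
    also have "\<dots> \<le> (LBINT x:{0..D}. survival (1 + \<epsilon>) k t x)"
    proof (intro set_integral_mono set_integrable_survival set_integrable_mult_right)
      fix x assume x: "x \<in> {0..D}"
      have "\<bar>max 0 (k s - x)\<bar> \<le> D" if "s \<in> {0..t}" for s
        using kD[of s] that x D0 by auto
      then have "set_integrable lborel {0..t} (\<lambda>s. max 0 (k s - x))"
        by (intro set_integrable_bounded[where B=D]) (auto simp: emeasure_lborel_Icc_eq)
      then have "excess k t x = excess k t0 x + (LBINT s:{t0..t}. max 0 (k s - x))"
        unfolding excess_def using t t0 by (intro set_integral_Icc_add) auto
      \<comment> \<open>At t0 itself \<open>k\<close> has the value D, which may differ from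
        \<open>f t0\<close>; the half-open interval avoids this point.\<close>
      also have "excess k t0 x = excess f t0 x"
        unfolding excess_def set_integral_Icc_eq_Ico
        by (intro set_lebesgue_integral_cong) (auto simp: k_def prolong_def t0_def)
      also have "(LBINT s:{t0..t}. max 0 (k s - x)) = (LBINT s:{t0..t}. D - x)"
        using x by (intro set_lebesgue_integral_cong) (auto simp: k_def prolong_def t0_def)
      also have "\<dots> = (t - t0) * (D - x)" using t by (subst set_integral_const) auto
      finally have ex: "excess k t x = excess f t0 x + (t - t0) * (D - x)" .
      \<comment> \<open>The area added after t0 is at most 2 * \<epsilon> * (D - x); the horizon
        adds \<epsilon> * x, which fits into the remaining 2 * \<epsilon> * x.\<close>
      have "(t - t0) * (D - x) \<le> (2 * \<epsilon>) * (D - x)" using t x by (intro mult_right_mono) (auto simp: t0_def)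
      moreover have "0 \<le> \<epsilon> * x" using e x by simp
      ultimately have "\<epsilon> * x + (t - t0) * (D - x) \<le> 2 * \<epsilon> * D" by (simp add: algebra_simps)
      then show "exp (- (2 * \<epsilon> * D)) * survival 1 f t0 x \<le> survival (1 + \<epsilon>) k t x"
        by (simp add: survival_def ex algebra_simps flip: exp_add)
    qed (use e in auto)
    finally show ?thesis by (simp add: rate_def kt)
  qed
  have int: "set_integrable lborel {0..<1 + \<epsilon>} (rate (1 + \<epsilon>) k)"
  proof (rule set_integrable_bounded[where B=D])
    fix t assume "t \<in> {0..<1 + \<epsilon>}"
    then show "\<bar>rate (1 + \<epsilon>) k t\<bar> \<le> D"
      using rate_le_self[OF km kn, of "1 + \<epsilon>" t] rate_nonneg[of "1 + \<epsilon>" k t] kD[of t] e by auto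
  qed (use e in \<open>auto simp: emeasure_lborel_Ico\<close>)
  have i1: "set_integrable lborel {0..<t0} (rate (1 + \<epsilon>) k)"
    and i2: "set_integrable lborel {t0..<1 + \<epsilon>} (rate (1 + \<epsilon>) k)"
    using t0 by (auto intro!: set_integrable_subset[OF int] simp: t0_def)
  have "(LBINT t:{0..<t0}. rate 1 f t) - \<epsilon> * (LBINT t:{0..<t0}. moment f t) =
     (LBINT t:{0..<t0}. rate 1 f t - \<epsilon> * moment f t)"
    using t0 by (subst set_integral_diff) (auto intro!: set_integrable_rate set_integrable_moment_Ico set_integrable_mult_right)
  also have "\<dots> \<le> (LBINT t:{0..<t0}. rate (1 + \<epsilon>) k t)"
    using t0 i1 early by (intro set_integral_mono set_integral_diff set_integrable_rate set_integrable_moment_Ico set_integrable_mult_right) auto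
  finally have 1: "(LBINT t:{0..<t0}. rate 1 f t) - \<epsilon> * (LBINT t:{0..<t0}. moment f t) \<le> \<dots>" .
  have "2 * \<epsilon> * (exp (- (2 * \<epsilon> * D)) * (rate 1 f t0 + exp (- f t0) - exp (- D))) =
     (LBINT t:{t0..<1 + \<epsilon>}. exp (- (2 * \<epsilon> * D)) * (rate 1 f t0 + exp (- f t0) - exp (- D)))"
    using t0 e by (subst set_integral_const) (auto simp: t0_def)
  also have "\<dots> \<le> (LBINT t:{t0..<1 + \<epsilon>}. rate (1 + \<epsilon>) k t)"
    using late i2 t0 e by (intro set_integral_mono set_integrable_bounded[OF _ _ _ order.refl])
      (auto simp: emeasure_lborel_Ico)
  finally have 2: "2 * \<epsilon> * (exp (- (2 * \<epsilon> * D)) * (rate 1 f t0 + exp (- f t0) - exp (- D))) \<le> \<dots>" .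
  have 3: "(LBINT t:{0..<1 + \<epsilon>}. rate (1 + \<epsilon>) k t) =
     (LBINT t:{0..<t0}. rate (1 + \<epsilon>) k t) + (LBINT t:{t0..<1 + \<epsilon>}. rate (1 + \<epsilon>) k t)"
    using t0 int by (intro set_integral_Ico_add) (auto simp: t0_def)
  have 4: "total_rate f = (LBINT t:{0..<t0}. rate 1 f t) + (LBINT t:{t0..<1}. rate 1 f t)"
    unfolding total_rate_def using t0 by (intro set_integral_Ico_add set_integrable_rate) auto
  have "(LBINT t:{0..<1}. moment f t) = (LBINT t:{0..<t0}. moment f t) + (LBINT t:{t0..<1}. moment f t)"
    using t0 by (intro set_integral_Ico_add set_integrable_moment_Ico) auto
  moreover have "0 \<le> (LBINT t:{t0..<1}. moment f t)" by (intro set_integral_nonneg moment_nonneg)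
  ultimately have 5: "\<epsilon> * (LBINT t:{0..<t0}. moment f t) \<le> \<epsilon> * (LBINT t:{0..<1}. moment f t)"
    using e by (intro mult_left_mono) auto
  show ?thesis using 1 2 3 4 5 le unfolding k_def[symmetric] t0_def[symmetric] by (simp add: mult.assoc)
qed

text \<open>The hypotheses say that cut-off and prolonged curves do no better than f. The first
  yields integrability and \<phi>1 \<le> 1. The second refutes \<phi>1 < 1, an assumption that at
  the same time bounds the growth of f near time 1.\<close>

theorem integral_curve_rate_eq_1:
  assumes short: "\<And>c. 0 < c \<Longrightarrow> c < 1 \<Longrightarrow> (LBINT t:{0..<c}. rate c f t) \<le> total_rate f"
    and long: "\<And>\<epsilon> D. 0 < \<epsilon> \<Longrightarrow> \<epsilon> < 1 \<Longrightarrow> f (1 - \<epsilon>) \<le> D \<Longrightarrow>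
      (LBINT t:{0..<1 + \<epsilon>}. rate (1 + \<epsilon>) (prolong \<epsilon> D) t) \<le> total_rate f"
  shows "(LBINT t:{0..<1}. f t * rate 1 f t) = 1"
proof -
  define \<phi> where "\<phi> t = (LBINT s:{0..t}. f s * rate 1 f s)" for t
  define \<psi> where "\<psi> t = (LBINT s:{0..t}. moment f s)" for t
  define u where "u t = rate 1 f t + exp (- f t)" for t
  define \<phi>1 where "\<phi>1 = (LBINT t:{0..<1}. f t * rate 1 f t)"
  define \<psi>1 where "\<psi>1 = (LBINT t:{0..<1}. moment f t)"
  have u: "u t = 1 - \<phi> t + \<psi> t" if "0 \<le> t" "t < 1" for t
    using rate_plus_exp[OF that] by (simp add: u_def \<phi>_def \<psi>_def)
  have \<phi>_diff: "\<phi> b - \<phi> a = (LBINT s:{a..b}. f s * rate 1 f s)" if "0 \<le> a" "a \<le> b" "b < 1" for a b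
    using set_integral_Icc_add[OF set_integrable_f_Icc(1), of b a] that by (simp add: \<phi>_def)
  have \<phi>_mono: "\<phi> a \<le> \<phi> b" if "0 \<le> a" "a \<le> b" "b < 1" for a b
    using \<phi>_diff[OF that] set_integral_nonneg[of "{a..b}" "\<lambda>s. f s * rate 1 f s" lborel]
    by (simp add: rate_nonneg f_nonneg)
  have \<psi>_mono: "\<psi> a \<le> \<psi> b" if "0 \<le> a" "a \<le> b" "b < 1" for a b
    using set_integral_Icc_add[OF set_integrable_f_Icc(2), of b a] that
      set_integral_nonneg[of "{a..b}" "moment f" lborel]
    by (simp add: \<psi>_def moment_nonneg)
  have \<psi>1_diff: "\<psi>1 - \<psi> t = (LBINT s:{t..<1}. moment f s)" if "0 \<le> t" "t < 1" for t
    using set_integral_Ico_add[of 0 1 "moment f" t] that set_integrable_moment_Ico[of "{0..<1}"]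
    by (simp add: \<psi>_def \<psi>1_def set_integral_Icc_eq_Ico)
  have \<psi>_le: "\<psi> t \<le> \<psi>1" if "0 \<le> t" "t < 1" for t
    using \<psi>1_diff[OF that] set_integral_nonneg[of "{t..<1}" "moment f" lborel] by (simp add: moment_nonneg)
  have \<psi>1_nonneg: "0 \<le> \<psi>1" unfolding \<psi>1_def by (intro set_integral_nonneg moment_nonneg)
  have ci: "set_integrable lborel {t..<1} (\<lambda>_. c)" for t c :: real
    by (cases "t \<le> 1") (auto intro!: set_integrable_bounded[OF _ _ _ order.refl] simp: emeasure_lborel_Ico)
  \<comment> \<open>\<open>rate\<close> is below u = 1 - \<phi> + \<psi>; after t, \<phi> only grows
    and \<psi> stays below \<psi>1.\<close>
  have rate_tail: "(LBINT s:{t..<1}. rate 1 f s) \<le> (1 - t) * (1 - \<phi> t + \<psi>1)" if t: "0 \<le> t" "t < 1" for t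
  proof -
    have "rate 1 f s \<le> 1 - \<phi> t + \<psi>1" if "s \<in> {t..<1}" for s
      using u[of s] \<phi>_mono[of t s] \<psi>_le[of s] exp_gt_zero[of "- f s"] t that
      unfolding u_def atLeastLessThan_iff by linarith
    then have "(LBINT s:{t..<1}. rate 1 f s) \<le> (LBINT s:{t..<1}. 1 - \<phi> t + \<psi>1)"
      using t ci by (intro set_integral_mono set_integrable_rate) auto
    then show ?thesis using t by (subst (asm) set_integral_const) auto
  qed
  \<comment> \<open>By \<open>shorter_horizon\<close>, (1 - c) * \<psi> c is at most the tail of
    \<open>rate\<close>, which \<open>rate_tail\<close> bounds; the common factor 1 - c
    cancels.\<close>
  have \<phi>_le: "\<phi> c \<le> 1 + \<psi>1 - \<psi> c" if c: "0 < c" "c < 1" for c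
  proof -
    have "(1 - c) * \<psi> c \<le> (1 - c) * (1 - \<phi> c + \<psi>1)"
      using shorter_horizon[OF c short[OF c]] rate_tail[of c] c
      unfolding \<psi>_def set_integral_Icc_eq_Ico by linarith
    then show ?thesis using c by simp
  qed
  \<comment> \<open>As f may be unbounded near 1, integrability is obtained by monotone convergence
    from the uniform bound on \<phi> c for c < 1.\<close>
  have int: "set_integrable lborel {0..<1} (\<lambda>s. f s * rate 1 f s)"
  proof -
    define c where "c n = 1 - 1 / real (n + 2)" for n
    have c: "0 < c n" "c n < 1" for n by (auto simp: c_def)
    have c_mono: "c m \<le> c n" if "m \<le> n" for m n
      using that by (auto simp: c_def frac_le)
    have c_lim: "c \<longlonglongrightarrow> 1"
    proof -
      have "(\<lambda>n. 1 - 1 / real (n + 2)) \<longlonglongrightarrow> 1 - 0"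
        by (intro tendsto_diff tendsto_const LIMSEQ_ignore_initial_segment[OF lim_1_over_n])
      then show ?thesis by (simp add: c_def [abs_def])
    qed
    have "\<phi> (c n) \<le> 1 + \<psi>1" for n
      using \<phi>_le[OF c[of n]] set_integral_nonneg[of "{0..c n}" "moment f" lborel]
      by (simp add: \<psi>_def moment_nonneg)
    moreover have "incseq (\<lambda>n. \<phi> (c n))"
      unfolding incseq_def using c c_mono by (intro allI impI \<phi>_mono) (auto intro: less_imp_le)
    ultimately obtain x where x: "(\<lambda>n. \<phi> (c n)) \<longlonglongrightarrow> x"
      using incseq_convergent by (metis)
    have "integrable lborel (\<lambda>s. indicator {0..<1} s *\<^sub>R (f s * rate 1 f s))"
    proof (rule integrable_monotone_convergence[where f="\<lambda>n s. indicator {0..c n} s *\<^sub>R (f s * rate 1 f s)" and x=x])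
      show "integrable lborel (\<lambda>s. indicator {0..c n} s *\<^sub>R (f s * rate 1 f s))" for n
        using set_integrable_f_Icc(1)[OF c(2)] by (simp add: set_integrable_def)
      show "AE s in lborel. mono (\<lambda>n. indicator {0..c n} s *\<^sub>R (f s * rate 1 f s))"
        using c_mono by (intro AE_I2 monoI) (fastforce simp: indicator_def rate_nonneg f_nonneg)
      show "AE s in lborel. (\<lambda>n. indicator {0..c n} s *\<^sub>R (f s * rate 1 f s)) \<longlonglongrightarrow> indicator {0..<1} s *\<^sub>R (f s * rate 1 f s)"
      proof (intro AE_I2 tendsto_scaleR tendsto_const)
        fix s
        show "(\<lambda>n. indicator {0..c n} s) \<longlonglongrightarrow> (indicator {0..<1} s :: real)"
        proof (cases "s \<in> {0..<1}")
          case True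
          then have "\<forall>\<^sub>F n in sequentially. s < c n" using order_tendstoD(1)[OF c_lim, of s] by simp
          then have "\<forall>\<^sub>F n in sequentially. indicator {0..c n} s = (1::real)"
            by eventually_elim (use True in auto)
          then show ?thesis using True by (simp add: tendsto_eventually)
        next
          case False
          then have "indicator {0..c n} s = (0::real)" for n using c(2)[of n] by (auto simp: indicator_def)
          then show ?thesis using False by simp
        qed
      qed
      show "(\<lambda>n. LBINT s. indicator {0..c n} s *\<^sub>R (f s * rate 1 f s)) \<longlonglongrightarrow> x"
        using x by (simp add: \<phi>_def set_lebesgue_integral_def)
    qed simp
    then show ?thesis by (simp add: set_integrable_def)
  qed
  have \<phi>_lim: "(\<phi> \<longlongrightarrow> \<phi>1) (at_left 1)" and \<psi>_lim: "(\<psi> \<longlongrightarrow> \<psi>1) (at_left 1)"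
    unfolding \<phi>_def \<phi>1_def \<psi>_def \<psi>1_def
    using int set_integrable_moment_Ico[of "{0..<1}"]
    by (auto intro!: tendsto_set_lebesgue_integral_at_left)
  have "\<phi>1 \<le> 1 + \<psi>1 - \<psi>1"
  proof (rule tendsto_le[OF _ _ \<phi>_lim])
    show "((\<lambda>c. 1 + \<psi>1 - \<psi> c) \<longlongrightarrow> 1 + \<psi>1 - \<psi>1) (at_left 1)" by (intro tendsto_intros \<psi>_lim)
    show "\<forall>\<^sub>F c in at_left 1. \<phi> c \<le> 1 + \<psi>1 - \<psi> c"
      using eventually_at_left_real[OF zero_less_one] by eventually_elim (auto intro: \<phi>_le)
  qed auto
  moreover have "\<not> \<phi>1 < 1"
  proof
    assume less: "\<phi>1 < 1"
    define u1 where "u1 = 1 - \<phi>1 + \<psi>1"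
    have u1: "\<psi>1 < u1" "0 < u1" using less \<psi>1_nonneg by (auto simp: u1_def)
    have left: "filterlim (\<lambda>\<epsilon>::real. 1 - \<epsilon>) (at_left 1) (at_right 0)"
      unfolding filterlim_at by (auto intro!: tendsto_eq_intros simp: eventually_at_filter)
    note \<phi>_lim' = filterlim_compose[OF \<phi>_lim left] and \<psi>_lim' = filterlim_compose[OF \<psi>_lim left]
    have small: "\<forall>\<^sub>F \<epsilon>::real in at_right 0. 0 < \<epsilon> \<and> \<epsilon> < 1"
      using eventually_at_right_real[OF zero_less_one] by eventually_elim auto
    \<comment> \<open>A lower bound for u on [1 - \<epsilon>, 1), since \<phi> is at most \<phi>1
      and \<psi> at least \<psi> (1 - \<epsilon>). Its limit u1 is positive because \<phi>1 <
      1.\<close>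
    define lo where "lo \<epsilon> = 1 - \<phi>1 + \<psi> (1 - \<epsilon>)" for \<epsilon>
    have lo_lim: "(lo \<longlongrightarrow> u1) (at_right 0)"
      unfolding lo_def u1_def by (intro tendsto_intros \<psi>_lim')
    have \<phi>1_diff: "\<phi>1 - \<phi> t = (LBINT s:{t..<1}. f s * rate 1 f s)" if "0 \<le> t" "t < 1" for t
      using set_integral_Ico_add[OF int, of t] that
      by (simp add: \<phi>_def \<phi>1_def set_integral_Icc_eq_Ico)
    have "\<phi> t \<le> \<phi>1" if "0 \<le> t" "t < 1" for t
      using \<phi>1_diff[OF that] set_integral_nonneg[of "{t..<1}" "\<lambda>s. f s * rate 1 f s" lborel]
      by (simp add: rate_nonneg f_nonneg)
    note \<phi>_le1 = this
    \<comment> \<open>On [t, 1) the curve is at least f t and \<open>rate\<close> at least lo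
      \<epsilon> - exp (- f t). Integrate the product and use f t * exp (- f t) \<le> 1.\<close>
    have bound: "\<epsilon> * f (1 - \<epsilon>) * lo \<epsilon> \<le> \<epsilon> + (\<phi>1 - \<phi> (1 - \<epsilon>))" if e: "0 < \<epsilon>" "\<epsilon> < 1" for \<epsilon>
    proof -
      define t where "t = 1 - \<epsilon>"
      have t: "0 \<le> t" "t < 1" "1 - t = \<epsilon>" using e by (auto simp: t_def)
      have pw: "lo \<epsilon> - exp (- f t) \<le> rate 1 f s" if "s \<in> {t..<1}" for s
        using u[of s] \<phi>_le1[of s] \<psi>_mono[of t s] f_mono[of t s] t that
        exp_le_cancel_iff[of "- f s" "- f t"] unfolding u_def lo_def t_def[symmetric] atLeastLessThan_iff by linarith
      have "f t * (lo \<epsilon> - exp (- f t)) * \<epsilon> = (LBINT s:{t..<1}. f t * (lo \<epsilon> - exp (- f t)))"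
        using t by (subst set_integral_const) auto
      also have "\<dots> \<le> (LBINT s:{t..<1}. f s * rate 1 f s)"
      proof (intro set_integral_mono ci)
        show "set_integrable lborel {t..<1} (\<lambda>s. f s * rate 1 f s)"
          by (rule set_integrable_subset[OF int]) (use t in auto)
        fix s assume s: "s \<in> {t..<1}"
        have "f t * (lo \<epsilon> - exp (- f t)) \<le> f t * rate 1 f s"
          using pw[OF s] f_nonneg by (intro mult_left_mono) auto
        also have "\<dots> \<le> f s * rate 1 f s"
          using f_mono[of t s] s t by (intro mult_right_mono rate_nonneg) auto
        finally show "f t * (lo \<epsilon> - exp (- f t)) \<le> f s * rate 1 f s" .
      qed
      also have "\<dots> = \<phi>1 - \<phi> t" using \<phi>1_diff t by simp
      finally have 1: "\<epsilon> * f t * lo \<epsilon> \<le> \<epsilon> * (f t * exp (- f t)) + (\<phi>1 - \<phi> t)"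
        by (simp add: algebra_simps)
      have "f t \<le> exp (f t)" using exp_ge_add_one_self[of "f t"] by linarith
      then have "f t * exp (- f t) \<le> 1" by (simp add: exp_minus field_simps)
      then have "\<epsilon> * (f t * exp (- f t)) \<le> \<epsilon> * 1" using e by (intro mult_left_mono) auto
      then show ?thesis using 1 by (simp add: t_def)
    qed
    \<comment> \<open>By \<open>bound\<close>, this is at most \<epsilon> plus the tail of a
      convergent integral, divided by lo \<epsilon>, which stays away from 0.\<close>
    have ef: "((\<lambda>\<epsilon>. \<epsilon> * f (1 - \<epsilon>)) \<longlongrightarrow> 0) (at_right 0)"
    proof (rule tendsto_sandwich[OF _ _ tendsto_const])
      show "\<forall>\<^sub>F \<epsilon> in at_right 0. 0 \<le> \<epsilon> * f (1 - \<epsilon>)"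
        using small by eventually_elim (simp add: f_nonneg)
      show "\<forall>\<^sub>F \<epsilon> in at_right 0. \<epsilon> * f (1 - \<epsilon>) \<le> (\<epsilon> + (\<phi>1 - \<phi> (1 - \<epsilon>))) / lo \<epsilon>"
        using small order_tendstoD(1)[OF lo_lim u1(2)]
        by eventually_elim (use bound in \<open>auto simp: pos_le_divide_eq\<close>)
      have "((\<lambda>\<epsilon>. (\<epsilon> + (\<phi>1 - \<phi> (1 - \<epsilon>))) / lo \<epsilon>) \<longlongrightarrow> (0 + (\<phi>1 - \<phi>1)) / u1) (at_right 0)"
        using u1 by (intro tendsto_intros \<phi>_lim' lo_lim) auto
      then show "((\<lambda>\<epsilon>. (\<epsilon> + (\<phi>1 - \<phi> (1 - \<epsilon>))) / lo \<epsilon>) \<longlongrightarrow> 0) (at_right 0)" by simp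
    qed
    \<comment> \<open>A lower bound for the left side of \<open>longer_horizon\<close> over
      \<epsilon>, with the height D = f (1 - \<epsilon>) + 1 / sqrt \<epsilon>. This D tends to
      infinity, yet \<epsilon> * D = \<epsilon> * f (1 - \<epsilon>) + sqrt \<epsilon> tends to
      0.\<close>
    define g where "g \<epsilon> = 2 * exp (- (2 * (\<epsilon> * f (1 - \<epsilon>) + sqrt \<epsilon>))) * (1 - \<phi> (1 - \<epsilon>) + \<psi> (1 - \<epsilon>) - exp (- (1 / sqrt \<epsilon>)))" for \<epsilon>
    have sq: "((\<lambda>\<epsilon>::real. sqrt \<epsilon>) \<longlongrightarrow> 0) (at_right 0)"
      by (rule tendsto_eq_rhs[OF tendsto_real_sqrt[OF tendsto_ident_at]]) simp
    have "filterlim (\<lambda>\<epsilon>::real. 1 / sqrt \<epsilon>) at_top (at_right 0)"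
      unfolding divide_inverse mult_1
      by (intro filterlim_compose[OF filterlim_inverse_at_top_right])
         (auto simp: filterlim_at sq eventually_at_filter)
    then have ex: "((\<lambda>\<epsilon>::real. exp (- (1 / sqrt \<epsilon>))) \<longlongrightarrow> 0) (at_right 0)"
      by (intro filterlim_compose[OF exp_at_bot]) (simp add: filterlim_uminus_at_bot)
    have "(g \<longlongrightarrow> 2 * exp (- (2 * (0 + 0))) * (1 - \<phi>1 + \<psi>1 - 0)) (at_right 0)"
      unfolding g_def by (intro tendsto_intros \<phi>_lim' \<psi>_lim' ef sq ex)
    then have g_lim: "(g \<longlongrightarrow> 2 * u1) (at_right 0)" by (simp add: u1_def)
    \<comment> \<open>The limit of \<open>longer_horizon\<close> divided by \<epsilon> reads 2 * u1
      \<le> u1 + \<psi>1, whereas u1 > \<psi>1.\<close>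
    have "2 * u1 \<le> (1 - \<phi>1 + \<psi>1) + \<psi>1"
    proof (rule tendsto_le[OF _ _ g_lim])
      show "((\<lambda>\<epsilon>. (1 - \<phi> (1 - \<epsilon>) + \<psi>1) + \<psi>1) \<longlongrightarrow> (1 - \<phi>1 + \<psi>1) + \<psi>1) (at_right 0)"
        by (intro tendsto_intros \<phi>_lim')
      show "\<forall>\<^sub>F \<epsilon> in at_right 0. g \<epsilon> \<le> (1 - \<phi> (1 - \<epsilon>) + \<psi>1) + \<psi>1"
        using small
      proof eventually_elim
        case (elim \<epsilon>)
        then have e: "0 < \<epsilon>" "\<epsilon> < 1" by auto
        define D where "D = f (1 - \<epsilon>) + 1 / sqrt \<epsilon>"
        have D: "f (1 - \<epsilon>) \<le> D" using e by (simp add: D_def)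
        have sqe: "\<epsilon> / sqrt \<epsilon> = sqrt \<epsilon>" using e by (simp add: real_div_sqrt)
        have "exp (- D) \<le> exp (- (1 / sqrt \<epsilon>))" using f_nonneg[of "1 - \<epsilon>"] by (simp add: D_def)
        then have "2 * exp (- (2 * \<epsilon> * D)) * (u (1 - \<epsilon>) - exp (- (1 / sqrt \<epsilon>))) \<le>
          2 * exp (- (2 * \<epsilon> * D)) * (u (1 - \<epsilon>) - exp (- D))"
          by (intro mult_left_mono) auto
        moreover have "2 * exp (- (2 * \<epsilon> * D)) * (u (1 - \<epsilon>) - exp (- (1 / sqrt \<epsilon>))) = g \<epsilon>"
        proof -
          have "2 * \<epsilon> * D = 2 * (\<epsilon> * f (1 - \<epsilon>) + sqrt \<epsilon>)"
            using sqe by (simp add: D_def distrib_left mult.assoc)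
          then show ?thesis using u[of "1 - \<epsilon>"] e by (simp add: g_def)
        qed
        moreover have "\<epsilon> * (2 * exp (- (2 * \<epsilon> * D)) * (u (1 - \<epsilon>) - exp (- D))) \<le> \<epsilon> * ((1 - \<phi> (1 - \<epsilon>) + \<psi>1) + \<psi>1)"
          using longer_horizon[OF e D long[OF e D]] rate_tail[of "1 - \<epsilon>"] e
          by (simp add: u_def \<psi>1_def algebra_simps)
        ultimately show ?case using e by simp
      qed
    qed auto
    then show False using u1 by (simp add: u1_def)
  qed
  ultimately show ?thesis by (simp add: \<phi>1_def)
qed

end

subsection \<open>Comparison with the winning rate\<close>

context curve
begin

text \<open>Sublevel sets of a nondecreasing function are initial intervals, so their supremum is
  their length; for the empty set the default 0 is the length too. In this form Fubini
  applies.\<close>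

lemma threshold_inverse_eq_measure:
  "threshold_inverse f z = measure lborel {s \<in> {0..<1}. f s < z}"
proof (cases "{s \<in> {0..<1}. f s < z} = {}")
  case True
  then show ?thesis unfolding threshold_inverse_def True by (simp del: atLeastLessThan_iff)
next
  case False
  define B where "B = {s \<in> {0..<1}. f s < z}"
  define m where "m = Sup B"
  have B: "B \<noteq> {}" "bdd_above B" using False unfolding B_def by (auto intro!: bdd_aboveI[of _ 1])
  have [measurable]: "B \<in> sets borel" unfolding B_def by measurable
  have sub: "B \<subseteq> {0..m}" using cSup_upper[OF _ B(2)] by (auto simp: m_def B_def)
  have sup: "{0..<m} \<subseteq> B"
  proof
    fix s assume s: "s \<in> {0..<m}"
    then obtain r where "r \<in> B" "s < r" using less_cSup_iff[OF B] by (auto simp: m_def)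
    then show "s \<in> B" using s f_mono[of s r] by (auto simp: B_def)
  qed
  have m: "0 \<le> m" using B(1) sub by auto
  have fin: "B \<in> fmeasurable lborel"
    by (rule fmeasurableI2[of "{0..m}"]) (use sub in \<open>auto intro!: fmeasurableI simp: emeasure_lborel_Icc_eq\<close>)
  have "measure lborel B \<le> measure lborel {0..m}" using sub
    by (intro measure_mono_fmeasurable) (auto intro!: fmeasurableI simp: emeasure_lborel_Icc_eq)
  moreover have "measure lborel {0..<m} \<le> measure lborel B"
    using sup fin by (intro measure_mono_fmeasurable) auto
  ultimately have "measure lborel B = m" using m by simp
  then show ?thesis using False unfolding threshold_inverse_def B_def[symmetric] m_def by auto
qed

text \<open>Both sides are the area of the points (s, z) with f s < z \<le> x, sliced in the two
  directions.\<close>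

lemma threshold_inverse_integral_eq:
  assumes x: "0 \<le> x"
  shows "threshold_inverse_integral f x = (LBINT s:{0..<1}. max 0 (x - f s))"
proof -
  define g where "g z s = (if 0 \<le> z \<and> z \<le> x \<and> 0 \<le> s \<and> s < 1 \<and> f s < z then 1 else (0::real))" for z s
  have gi: "integrable (lborel \<Otimes>\<^sub>M lborel) (case_prod g)"
  proof (rule integrableI_bounded_set[where A="{0..x} \<times> {0..<1}" and B="1"])
    show "emeasure (lborel \<Otimes>\<^sub>M lborel) ({0..x} \<times> {0..<1::real}) < \<infinity>"
      by (subst lborel.emeasure_pair_measure_Times) (auto simp: emeasure_lborel_Icc_eq ennreal_mult_less_top)
    have "case_prod g = (\<lambda>p. if 0 \<le> fst p \<and> fst p \<le> x \<and> 0 \<le> snd p \<and> snd p < 1 \<and> f (snd p) < fst p then 1 else 0)"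
      by (auto simp: g_def)
    then show "case_prod g \<in> borel_measurable (lborel \<Otimes>\<^sub>M lborel)" by simp
    show "AE p in lborel \<Otimes>\<^sub>M lborel. p \<notin> {0..x} \<times> {0..<1} \<longrightarrow> case_prod g p = 0"
      by (intro AE_I2) (auto simp: g_def split: if_splits)
  qed (auto simp: g_def)
  have "threshold_inverse_integral f x = (LBINT z. LBINT s. g z s)"
    unfolding threshold_inverse_integral_def set_lebesgue_integral_def threshold_inverse_eq_measure
  proof (intro Bochner_Integration.integral_cong refl)
    fix z
    have "(LBINT s. g z s) = (LBINT s. indicator {0..x} z * indicator {s \<in> {0..<1}. f s < z} s)"
      by (intro Bochner_Integration.integral_cong) (auto simp: g_def)
    then show "indicator {0..x} z *\<^sub>R measure lborel {s \<in> {0..<1}. f s < z} = (LBINT s. g z s)" by simp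
  qed
  also have "\<dots> = (LBINT s. LBINT z. g z s)"
    using lborel_pair.Fubini_integral[OF gi] by simp
  also have "\<dots> = (LBINT s:{0..<1}. max 0 (x - f s))"
    unfolding set_lebesgue_integral_def
  proof (intro Bochner_Integration.integral_cong refl)
    fix s
    have "(LBINT z. g z s) = (LBINT z. indicator {0..<1} s * indicator {f s<..x} z)"
      using f_nonneg[of s] by (intro Bochner_Integration.integral_cong) (auto simp: g_def)
    then show "(LBINT z. g z s) = indicator {0..<1} s *\<^sub>R max 0 (x - f s)"
      by (cases "f s \<le> x") auto
  qed
  finally show ?thesis .
qed

text \<open>After t the curve is at least x, so the integral of max 0 (x - f s) stops at t. Before
  t, f s + max 0 (x - f s) = x + max 0 (f s - x), and t * x + x * (1 - t) = x.\<close>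

lemma winning_rate_eq_survival:
  assumes t: "0 \<le> t" "t < 1" and x: "0 \<le> x" "x \<le> f t"
  shows "winning_rate f t x = survival 1 f t x"
proof -
  have "threshold_inverse_integral f x = (LBINT s:{0..t}. max 0 (x - f s))"
  proof -
    have "indicat_real {0..<1} s *\<^sub>R max 0 (x - f s) = indicat_real {0..<t} s *\<^sub>R max 0 (x - f s)" for s
      using t x f_mono[of t s] by (auto simp: indicator_def)
    then show ?thesis
      unfolding threshold_inverse_integral_eq[OF x(1)] set_integral_Icc_eq_Ico
      by (simp only: set_lebesgue_integral_def)
  qed
  moreover have fi: "set_integrable lborel {0..t} f"
    using f_mono[OF _ _ t(2)] f_nonneg by (intro set_integrable_bounded[where B="f t"]) (auto simp: emeasure_lborel_Icc_eq)
  moreover have "set_integrable lborel {0..t} (\<lambda>s. max 0 (x - f s))"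
    using f_nonneg x by (intro set_integrable_bounded[where B=x]) (auto simp: emeasure_lborel_Icc_eq)
  ultimately have "threshold_integral f t + threshold_inverse_integral f x =
      (LBINT s:{0..t}. f s + max 0 (x - f s))"
    unfolding threshold_integral_def by (simp add: set_integral_add)
  also have "\<dots> = (LBINT s:{0..t}. x + max 0 (f s - x))"
    by (intro set_lebesgue_integral_cong) auto
  also have "\<dots> = (LBINT s:{0..t}. x) + excess f t x"
    unfolding excess_def using t set_integrable_f_Icc(3)
    by (intro set_integral_add) (auto intro!: set_integrable_bounded[OF _ _ _ order.refl] simp: emeasure_lborel_Icc_eq)
  also have "(LBINT s:{0..t}. x) = t * x" using t by (subst set_integral_const) auto
  finally show ?thesis by (simp add: winning_rate_def survival_def algebra_simps flip: exp_add)
qed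

lemma temporal_winning_rate_eq:
  assumes "0 \<le> t" "t < 1"
  shows "temporal_winning_rate f t = rate 1 f t"
  unfolding temporal_winning_rate_def rate_def
  using winning_rate_eq_survival[OF assms] by (intro set_lebesgue_integral_cong) auto

end

text \<open>Outside [0, 1) a threshold curve is arbitrary, possibly negative or not measurable. The
  value 0 there yields a \<open>curve\<close> and changes neither the success probability nor the
  temporal winning rate on [0, 1).\<close>

definition clip :: "(real \<Rightarrow> real) \<Rightarrow> real \<Rightarrow> real" where
  "clip f t = (if t \<in> {0..<1} then f t else 0)"

lemma curve_clip:
  assumes "threshold_curve f"
  shows "curve (clip f)"
proof
  have m: "mono_on {0..<1} f" using assms by (simp add: threshold_curve_def)
  have "(\<lambda>t. if t \<in> {0..<1} then f t else 0) \<in> borel_measurable borel"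
    by (subst measurable_If_restrict_space_iff)
      (use borel_measurable_mono_on_fnc[OF m] in \<open>auto simp: atLeastLessThan_def atLeast_def lessThan_def Int_def\<close>)
  then show "clip f \<in> borel_measurable borel" by (simp add: clip_def [abs_def])
  show "0 \<le> clip f t" for t using assms by (simp add: clip_def threshold_curve_def)
  show "clip f s \<le> clip f t" if "0 \<le> s" "s \<le> t" "t < 1" for s t
    using mono_onD[OF m, of s t] that by (simp add: clip_def)
qed

lemma temporal_winning_rate_clip:
  assumes "0 \<le> t" "t < 1"
  shows "temporal_winning_rate (clip f) t = temporal_winning_rate f t"
proof -
  have "threshold_integral (clip f) t = threshold_integral f t"
    unfolding threshold_integral_def using assms by (intro set_lebesgue_integral_cong) (auto simp: clip_def)
  moreover have "{t \<in> {0..<1}. clip f t < z} = {t \<in> {0..<1}. f t < z}" for z by (auto simp: clip_def)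
  then have "threshold_inverse (clip f) = threshold_inverse f"
    by (simp only: threshold_inverse_def [abs_def])
  moreover have "clip f t = f t" using assms by (simp add: clip_def)
  ultimately show ?thesis
    by (simp add: temporal_winning_rate_def winning_rate_def threshold_inverse_integral_def)
qed

lemma subgraph_clip: "subgraph (clip f) = subgraph f"
  by (auto simp: subgraph_def clip_def)

lemma success_prob_clip: "success_prob M X (clip f) = success_prob M X f"
  by (simp add: success_prob_def stopping_point_def subgraph_clip)

subsection \<open>Void probabilities\<close>

text \<open>The success event need not be measurable. Countable unions of inner and intersections of
  outer approximations have the same measure \<open>v\<close>, so they differ by a null set and the
  event belongs to the completion.\<close>

lemma completion_measure_sandwich:
  assumes "finite_measure M"
    and sw: "\<And>e. 0 < e \<Longrightarrow> \<exists>A\<in>sets M. \<exists>B\<in>sets M. A \<subseteq> E \<and> E \<subseteq> B \<and> v - e \<le> measure M A \<and> measure M B \<le> v + e"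
  shows "measure (completion M) E = v"
proof -
  interpret finite_measure M by fact
  define d where "d n = 1 / (real n + 1)" for n :: nat
  have d: "0 < d n" for n by (simp add: d_def)
  have dl: "d \<longlonglongrightarrow> 0" unfolding d_def [abs_def] using LIMSEQ_inverse_real_of_nat by (simp add: inverse_eq_divide add.commute)
  have "\<forall>n. \<exists>A B. A \<in> sets M \<and> B \<in> sets M \<and> A \<subseteq> E \<and> E \<subseteq> B \<and> v - d n \<le> measure M A \<and> measure M B \<le> v + d n"
  proof
    fix n show "\<exists>A B. A \<in> sets M \<and> B \<in> sets M \<and> A \<subseteq> E \<and> E \<subseteq> B \<and> v - d n \<le> measure M A \<and> measure M B \<le> v + d n"
      using sw[OF d[of n]] unfolding Bex_def by iprover
  qed
  then obtain A B where AB: "\<And>n. A n \<in> sets M" "\<And>n. B n \<in> sets M" "\<And>n. A n \<subseteq> E" "\<And>n. E \<subseteq> B n"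
      "\<And>n. v - d n \<le> measure M (A n)" "\<And>n. measure M (B n) \<le> v + d n"
    by metis
  define A' where "A' = (\<Union>n. A n)"
  define B' where "B' = (\<Inter>n. B n)"
  have s: "A' \<in> sets M" "B' \<in> sets M" using AB by (auto simp: A'_def B'_def)
  have i: "A' \<subseteq> E" "E \<subseteq> B'" using AB(3,4) unfolding A'_def B'_def by blast+
  have "v - d n \<le> measure M A'" for n
    using AB(5)[of n] finite_measure_mono[of "A n" A'] s by (force simp: A'_def)
  then have a: "v - 0 \<le> measure M A'"
    by (intro tendsto_upperbound[OF tendsto_diff[OF tendsto_const dl]]) auto
  have "measure M B' \<le> v + d n" for n
    using AB(6)[of n] finite_measure_mono[of B' "B n"] AB(2) by (force simp: B'_def)
  then have b: "measure M B' \<le> v + 0"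
    by (intro tendsto_lowerbound[OF tendsto_add[OF tendsto_const dl]]) auto
  have "measure M (B' - A') = 0"
    using finite_measure_Diff[OF s(2,1)] i a b measure_nonneg[of M "B' - A'"] by auto
  then have "B' - A' \<in> null_sets M" using s by (auto simp: null_sets_def emeasure_eq_measure)
  then have "E - A' \<in> null_sets (completion M)"
    using i by (intro null_sets_completion_subset[OF _ null_sets_completionI]) auto
  then have "A' \<union> (E - A') \<in> sets (completion M)"
    using s by (intro sets.Un) (auto simp: null_sets_def)
  moreover have "A' \<union> (E - A') = E" using i by auto
  ultimately have E: "E \<in> sets (completion M)" by simp
  interpret c: finite_measure "completion M"
    by (intro finite_measureI) (simp add: emeasure_completion emeasure_finite)
  have "measure M A' \<le> measure (completion M) E"
    using c.finite_measure_mono[OF i(1) E] s by (simp add: measure_completion)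
  moreover have "measure (completion M) E \<le> measure M B'"
    using c.finite_measure_mono[OF i(2)] s by (simp add: measure_completion sets_completionI_sets)
  ultimately show ?thesis using a b by simp
qed

locale unit_rate_process =
  fixes M :: "'a measure" and X :: "'a \<Rightarrow> (real \<times> real) set"
  assumes ppp: "poisson_point_process M X unit_rate"
begin

sublocale prob_space M
  using ppp by (simp add: poisson_point_process_def)

abbreviation "strip \<equiv> {0..1} \<times> {0..} :: (real \<times> real) set"

lemma strip_borel [measurable]: "strip \<in> sets borel"
  by (intro borel_Times) auto

lemma sets_unit_rate: "A \<in> sets unit_rate \<longleftrightarrow> A \<in> sets borel \<and> A \<subseteq> strip"
  unfolding unit_rate_def by (subst sets_restrict_space_iff) auto

lemma emeasure_unit_rate: "A \<subseteq> strip \<Longrightarrow> emeasure unit_rate A = emeasure lborel A"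
  unfolding unit_rate_def by (subst emeasure_restrict_space) auto

text \<open>Bounded in area rather than in extent: the half-line at time 1 qualifies. These are the
  regions with a Poisson distributed count.\<close>

definition bounded_region :: "(real \<times> real) set \<Rightarrow> bool" where
  "bounded_region A \<longleftrightarrow> A \<in> sets borel \<and> A \<subseteq> strip \<and> emeasure lborel A < \<infinity>"

definition void :: "(real \<times> real) set \<Rightarrow> 'a set" where
  "void A = {\<omega> \<in> space M. X \<omega> \<inter> A = {}}"

text \<open>An infinite set has \<open>card\<close> 0, so the equation also forces
  finiteness.\<close>

definition single :: "(real \<times> real) set \<Rightarrow> 'a set" where
  "single A = {\<omega> \<in> space M. card (X \<omega> \<inter> A) = 1}"

lemma point_count_eq_0: "point_count S A = 0 \<longleftrightarrow> S \<inter> A = {}"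
  by (simp add: point_count_def emeasure_count_space_eq_0)

lemma point_count_eq_1: "point_count S A = 1 \<longleftrightarrow> card (S \<inter> A) = 1"
  by (auto simp: point_count_def emeasure_count_space card_ge_0_finite)

lemma X_strip: "\<omega> \<in> space M \<Longrightarrow> X \<omega> \<subseteq> strip"
  using ppp unfolding poisson_point_process_def unit_rate_def by (auto simp: space_restrict_space)

lemma measurable_point_count [measurable]:
  "A \<in> sets borel \<Longrightarrow> A \<subseteq> strip \<Longrightarrow> (\<lambda>\<omega>. point_count (X \<omega>) A) \<in> borel_measurable M"
  using ppp sets_unit_rate unfolding poisson_point_process_def by blast

lemma void_alt: "void A = (\<lambda>\<omega>. point_count (X \<omega>) A) -` {0} \<inter> space M"
  by (auto simp: void_def point_count_eq_0)

lemma single_alt: "single A = (\<lambda>\<omega>. point_count (X \<omega>) A) -` {1} \<inter> space M"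
  by (auto simp: single_def point_count_eq_1)

lemma events [measurable]:
  assumes "A \<in> sets borel" "A \<subseteq> strip"
  shows "void A \<in> events" "single A \<in> events"
  unfolding void_alt single_alt using measurable_point_count[OF assms]
  by (auto intro!: measurable_sets)

lemma counts:
  assumes "A \<in> sets unit_rate"
  shows "if emeasure unit_rate A = \<infinity> then AE \<omega> in M. point_count (X \<omega>) A = \<infinity>
    else \<forall>k::nat. prob {\<omega> \<in> space M. point_count (X \<omega>) A = of_nat k}
      = exp (- measure unit_rate A) * measure unit_rate A ^ k / fact k"
  using ppp assms unfolding poisson_point_process_def by blast

lemma prob_point_count:
  assumes "bounded_region A"
  shows "prob {\<omega> \<in> space M. point_count (X \<omega>) A = of_nat k} = exp (- measure lborel A) * measure lborel A ^ k / fact k"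
proof -
  have A: "A \<in> sets unit_rate" "emeasure unit_rate A \<noteq> \<infinity>" and m: "measure unit_rate A = measure lborel A"
    using assms sets_unit_rate by (auto simp: bounded_region_def emeasure_unit_rate measure_def)
  show ?thesis using counts[OF A(1)] A(2) unfolding m by simp
qed

lemma prob_void: "bounded_region A \<Longrightarrow> prob (void A) = exp (- measure lborel A)"
  using prob_point_count[of A 0] by (simp add: void_def point_count_eq_0)

lemma prob_single: "bounded_region A \<Longrightarrow> prob (single A) = measure lborel A * exp (- measure lborel A)"
  using prob_point_count[of A 1] by (simp add: single_def point_count_eq_1 mult.commute)

lemma prob_independent:
  assumes A: "A \<in> sets borel" "A \<subseteq> strip" and B: "B \<in> sets borel" "B \<subseteq> strip"
    and disj: "A \<inter> B = {}" and U: "U \<in> sets borel" "V \<in> sets borel"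
  shows "prob (((\<lambda>\<omega>. point_count (X \<omega>) A) -` U \<inter> space M) \<inter> ((\<lambda>\<omega>. point_count (X \<omega>) B) -` V \<inter> space M))
    = prob ((\<lambda>\<omega>. point_count (X \<omega>) A) -` U \<inter> space M) * prob ((\<lambda>\<omega>. point_count (X \<omega>) B) -` V \<inter> space M)"
proof -
  \<comment> \<open>Independence is given for families indexed by \<open>{..<n}\<close>; the two
    regions form such a family with n = 2.\<close>
  define R where "R i = (if i = (0::nat) then A else B)" for i
  define Y where "Y i = (if i = (0::nat) then U else V)" for i
  have "disjoint_family_on R {..<2}"
    using disj by (auto simp: disjoint_family_on_def R_def)
  moreover have "\<forall>i<2. R i \<in> sets unit_rate"
    using A B by (auto simp: R_def sets_unit_rate)
  ultimately have "indep_vars (\<lambda>_. borel) (\<lambda>i \<omega>. point_count (X \<omega>) (R i)) {..<2}"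
    using ppp unfolding poisson_point_process_def by blast
  then have "prob (\<Inter>i\<in>{..<2}. (\<lambda>\<omega>. point_count (X \<omega>) (R i)) -` Y i \<inter> space M) =
      (\<Prod>i\<in>{..<2}. prob ((\<lambda>\<omega>. point_count (X \<omega>) (R i)) -` Y i \<inter> space M))"
    by (rule indep_varsD) (use U in \<open>auto simp: Y_def lessThan_empty_iff\<close>)
  moreover have "{..<2::nat} = {0, 1}" by auto
  ultimately show ?thesis by (simp add: R_def Y_def)
qed

lemma prob_single_void:
  assumes "bounded_region A" "bounded_region B" "A \<inter> B = {}"
  shows "prob (single A \<inter> void B) = measure lborel A * exp (- (measure lborel A + measure lborel B))"
proof -
  have "prob (single A \<inter> void B) = prob (single A) * prob (void B)"
    unfolding single_alt void_alt using assms
    by (intro prob_independent) (auto simp: bounded_region_def)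
  then show ?thesis using prob_single[OF assms(1)] prob_void[OF assms(2)]
    by (simp add: exp_diff exp_minus divide_inverse)
qed

lemma prob_nonvoid:
  assumes "bounded_region A"
  shows "prob (space M - void A) \<le> measure lborel A"
proof -
  have "void A \<in> events" using assms by (intro events) (auto simp: bounded_region_def)
  then show ?thesis
    using prob_compl[of "void A"] prob_void[OF assms] exp_ge_add_one_self[of "- measure lborel A"] by simp
qed

text \<open>For upper bounds a nonempty cell is enough; 1 - exp (- m) \<le> m replaces the exact
  probability of a single atom.\<close>

lemma prob_nonvoid_void:
  assumes "bounded_region A" "bounded_region B" "A \<inter> B = {}"
  shows "prob ((space M - void A) \<inter> void B) \<le> measure lborel A * exp (- measure lborel B)"
proof -
  have e: "space M - void A = (\<lambda>\<omega>. point_count (X \<omega>) A) -` (- {0}) \<inter> space M"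
    by (auto simp: void_alt)
  have "prob ((space M - void A) \<inter> void B) = prob (space M - void A) * prob (void B)"
    unfolding e void_alt[of B] using assms
    by (intro prob_independent) (auto simp: bounded_region_def)
  then show ?thesis
    using prob_nonvoid[OF assms(1)] prob_void[OF assms(2)] by (simp add: mult_right_mono)
qed

text \<open>The Poisson weights sum to 1, so the count is almost surely a natural number.\<close>

lemma AE_finite:
  assumes A: "bounded_region A"
  shows "AE \<omega> in M. finite (X \<omega> \<inter> A)"
proof -
  define N where "N k = {\<omega> \<in> space M. point_count (X \<omega>) A = of_nat k}" for k :: nat
  have [measurable]: "(\<lambda>\<omega>. point_count (X \<omega>) A) \<in> borel_measurable M"
    using A by (intro measurable_point_count) (auto simp: bounded_region_def)
  have N: "N k \<in> events" for k unfolding N_def by measurable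
  have "disjoint_family N" by (auto simp: disjoint_family_on_def N_def)
  then have "(\<lambda>k. prob (N k)) sums prob (\<Union>k. N k)"
    using N by (intro finite_measure_UNION) auto
  moreover have "(\<lambda>k. exp (- measure lborel A) * (measure lborel A ^ k /\<^sub>R fact k)) sums (exp (- measure lborel A) * exp (measure lborel A))"
    by (intro sums_mult exp_converges)
  moreover have "exp (- measure lborel A) * exp (measure lborel A) = 1"
    by (simp flip: exp_add)
  moreover have "exp (- measure lborel A) * (measure lborel A ^ k /\<^sub>R fact k) = prob (N k)" for k
    unfolding N_def prob_point_count[OF A] by (simp add: divide_inverse)
  ultimately have "prob (\<Union>k. N k) = 1" by (metis (no_types, lifting) sums_cong sums_unique2)
  then have "AE \<omega> in M. \<omega> \<in> (\<Union>k. N k)"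
    using N by (subst prob_eq_1[symmetric]) auto
  then show ?thesis
  proof eventually_elim
    case (elim \<omega>)
    then obtain k where "point_count (X \<omega>) A = of_nat k" by (auto simp: N_def)
    then show ?case by (auto simp: point_count_def emeasure_count_space split: if_splits)
  qed
qed

lemma AE_nonempty: "AE \<omega> in M. X \<omega> \<noteq> {}"
proof -
  have "ennreal (real n) \<le> emeasure lborel {0::real..}" for n
    using emeasure_mono[of "{0..real n}" "{0..}" lborel] by simp
  then have emeasure_lborel_Ici: "emeasure lborel {0::real..} = \<infinity>"
    by (metis ennreal_of_nat_eq_real_of_nat ennreal_Ex_less_of_nat infinity_ennreal_def leD top.not_eq_extremum)
  have "emeasure lborel strip = emeasure lborel {0..1::real} * emeasure lborel {0::real..}"
    unfolding lborel_prod[symmetric] by (intro lborel.emeasure_pair_measure_Times) auto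
  then have "emeasure unit_rate strip = \<infinity>"
    by (simp add: emeasure_unit_rate emeasure_lborel_Ici)
  then have "AE \<omega> in M. point_count (X \<omega>) strip = \<infinity>"
    using counts[of strip] sets_unit_rate[of strip] by simp
  then show ?thesis by eventually_elim (auto simp: point_count_def)
qed

lemma bounded_region_box:
  assumes "0 \<le> a" "b \<le> 1" "0 \<le> K"
  shows "bounded_region ({a..b} \<times> {0..K})" "a \<le> b \<Longrightarrow> measure lborel ({a..b} \<times> {0..K}) = (b - a) * K"
proof -
  have 1: "emeasure lborel ({a..b} \<times> {0..K}) = emeasure lborel {a..b} * emeasure lborel {0..K}"
    unfolding lborel_prod[symmetric] by (intro lborel.emeasure_pair_measure_Times) auto
  then show "bounded_region ({a..b} \<times> {0..K})"
    using assms by (auto simp: bounded_region_def emeasure_lborel_Icc_eq ennreal_mult_less_top borel_Times)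
  show "measure lborel ({a..b} \<times> {0..K}) = (b - a) * K" if "a \<le> b"
    using 1 assms that by (simp add: measure_def enn2real_mult)
qed

text \<open>Without an accepted atom the stopping time is 1 by default, which would count as a
  success if the best atom arrived at time 1. The half-line at time 1 has area 0.\<close>

lemma AE_not_at_1: "AE \<omega> in M. X \<omega> \<inter> {1} \<times> {0..} = {}"
proof -
  have "emeasure lborel ({1::real} \<times> {0::real..}) = emeasure lborel {1::real} * emeasure lborel {0::real..}"
    unfolding lborel_prod[symmetric] by (intro lborel.emeasure_pair_measure_Times) auto
  then have 0: "emeasure lborel ({1::real} \<times> {0::real..}) = 0" by simp
  then have b: "bounded_region ({1} \<times> {0..})" by (auto simp: bounded_region_def intro!: borel_Times)
  have ev: "void ({1} \<times> {0..}) \<in> events"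
    using b by (intro events) (auto simp: bounded_region_def)
  have "prob (void ({1} \<times> {0..})) = 1" using prob_void[OF b] 0 by (simp add: measure_def)
  then have "AE \<omega> in M. \<omega> \<in> void ({1} \<times> {0..})"
    using prob_eq_1[OF ev] by simp
  then show ?thesis by eventually_elim (simp add: void_def)
qed

lemma bounded_region_subset:
  assumes "bounded_region A" "B \<in> sets borel" "B \<subseteq> A"
  shows "bounded_region B"
  using assms emeasure_mono[of B A lborel] by (auto simp: bounded_region_def)

end

subsection \<open>The success probability as an integral\<close>

lemma arg_min_eqI:
  fixes g :: "'a \<Rightarrow> 'b::linorder"
  assumes "P x" "\<And>y. P y \<Longrightarrow> g y \<le> g x \<Longrightarrow> y = x"
  shows "arg_min g P = x"
  unfolding arg_min_def
proof (rule some_equality)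
  show "is_arg_min g P x"
    using assms unfolding is_arg_min_def by (metis less_imp_le less_irrefl)
  show "y = x" if "is_arg_min g P y" for y
    using that assms unfolding is_arg_min_def by (meson not_le)
qed

text \<open>Made for infinite sets of atoms: a minimum exists as soon as only finitely many
  candidates lie at or below the level of some member \<open>q\<close>.\<close>

lemma arg_min_locally_finite:
  fixes g :: "'a \<Rightarrow> 'b::linorder"
  assumes "P q" "finite {x. P x \<and> g x \<le> g q}"
  shows "P (arg_min g P)" and "P y \<Longrightarrow> g (arg_min g P) \<le> g y"
proof -
  define A where "A = {x. P x \<and> g x \<le> g q}"
  have "finite A" "A \<noteq> {}" using assms by (auto simp: A_def)
  then obtain m where m: "m \<in> A" "\<And>x. x \<in> A \<Longrightarrow> g m \<le> g x"
    using arg_min_if_finite[of A g] by (metis not_le)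
  have "is_arg_min g P m"
    unfolding is_arg_min_def
  proof (intro conjI notI)
    show "P m" using m by (simp add: A_def)
    assume "\<exists>y. P y \<and> g y < g m"
    then obtain y where y: "P y" "g y < g m" by blast
    then have "y \<in> A" using m(1) by (auto simp: A_def)
    then show False using m(2) y(2) by (metis not_le)
  qed
  then have "is_arg_min g P (arg_min g P)" unfolding arg_min_def by (rule someI)
  then show "P (arg_min g P)" and "P y \<Longrightarrow> g (arg_min g P) \<le> g y"
    unfolding is_arg_min_def by (auto simp: not_less)
qed

lemma borel_Collect_prod:
  "Measurable.pred (borel \<Otimes>\<^sub>M borel) P \<Longrightarrow> Collect P \<in> sets (borel :: (real \<times> real) measure)"
  by (simp add: pred_def borel_prod space_pair_measure)

section \<open>Regions to be kept empty and cells below the curve\<close>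

context curve
begin

text \<open>Ties aside, an atom (t, x) below the curve is both the best atom and the first accepted
  one exactly when no atom lies here. The strict inequalities keep (t, x) itself outside.\<close>

definition region :: "real \<Rightarrow> real \<Rightarrow> (real \<times> real) set" where
  "region t x = {(s, y). 0 \<le> s \<and> s \<le> 1 \<and> 0 \<le> y \<and> (s < t \<and> y \<le> f s \<or> y < x)}"

text \<open>Half-open in both directions, so that the cells of a mesh are disjoint; y \<le> f s
  trims the cells that the curve crosses.\<close>

definition cell :: "real \<Rightarrow> real \<Rightarrow> real \<Rightarrow> real \<Rightarrow> (real \<times> real) set" where
  "cell a a' b b' = {(s, y). a \<le> s \<and> s < a' \<and> b \<le> y \<and> y < b' \<and> y \<le> f s}"

lemma borel_region [measurable]: "region t x \<in> sets borel"
proof -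
  have "region t x = {p. 0 \<le> fst p \<and> fst p \<le> 1 \<and> 0 \<le> snd p \<and> (fst p < t \<and> snd p \<le> f (fst p) \<or> snd p < x)}"
    by (auto simp: region_def)
  also have "\<dots> \<in> sets borel" by (rule borel_Collect_prod) measurable
  finally show ?thesis .
qed

lemma borel_cell [measurable]: "cell a a' b b' \<in> sets borel"
proof -
  have "cell a a' b b' = {p. a \<le> fst p \<and> fst p < a' \<and> b \<le> snd p \<and> snd p < b' \<and> snd p \<le> f (fst p)}"
    by (auto simp: cell_def)
  also have "\<dots> \<in> sets borel" by (rule borel_Collect_prod) measurable
  finally show ?thesis .
qed

lemma emeasure_region:
  assumes t: "0 \<le> t" "t < 1" and x: "0 \<le> x"
  shows "emeasure lborel (region t x) = ennreal (x + excess f t x)"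
proof -
  define h where "h s = indicator {0..1} s * x + indicator {0..t} s * max 0 (f s - x)" for s
  have hi: "integrable lborel h"
    using set_integrable_f_Icc(3)[OF t(2), of x] set_integrable_bounded[of "\<lambda>_. x" lborel "{0..1}" "x"] x
    by (auto simp: h_def [abs_def] set_integrable_def)
  have "(LBINT s::real. indicator {0..1} s * x) = x" by simp
  moreover have "integral\<^sup>L lborel h = (LBINT s::real. indicator {0..1} s * x) + excess f t x"
    unfolding h_def excess_def set_lebesgue_integral_def real_scaleR_def
    using set_integrable_f_Icc(3)[OF t(2), of x]
    by (subst Bochner_Integration.integral_add) (auto simp: set_integrable_def)
  ultimately have hI: "integral\<^sup>L lborel h = x + excess f t x" by simp
  \<comment> \<open>The part below the curve omits s = t, whereas \<open>excess\<close> integrates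
    over a closed interval; this single time is a null set.\<close>
  have slice: "emeasure lborel (Pair s -` region t x) = ennreal (h s)" if "s \<noteq> t" for s
  proof (cases "0 \<le> s \<and> s \<le> 1")
    case True
    show ?thesis
    proof (cases "s < t \<and> x \<le> f s")
      case True
      then have "Pair s -` region t x = {0..f s}"
        using \<open>0 \<le> s \<and> s \<le> 1\<close> by (auto simp: region_def)
      then show ?thesis using True \<open>0 \<le> s \<and> s \<le> 1\<close> f_nonneg[of s] by (simp add: h_def)
    next
      case False
      then have "Pair s -` region t x = {0..<x}"
        using \<open>0 \<le> s \<and> s \<le> 1\<close> that by (auto simp: region_def)
      moreover have "h s = x" using False \<open>0 \<le> s \<and> s \<le> 1\<close> that by (auto simp: h_def indicator_def)
      ultimately show ?thesis using x by simp
    qed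
  next
    case False
    then have "Pair s -` region t x = {}" "h s = 0" using t by (auto simp: region_def h_def)
    then show ?thesis by simp
  qed
  have "emeasure lborel (region t x) = (\<integral>\<^sup>+ s. emeasure lborel (Pair s -` region t x) \<partial>lborel)"
    unfolding lborel_prod[symmetric] by (rule lborel.emeasure_pair_measure_alt) (metis borel_region lborel_prod sets_lborel)
  also have "\<dots> = (\<integral>\<^sup>+ s. ennreal (h s) \<partial>lborel)"
    using AE_lborel_singleton[of t] by (intro nn_integral_cong_AE) (auto elim!: eventually_mono simp: slice)
  also have "\<dots> = ennreal (integral\<^sup>L lborel h)"
    using x by (intro nn_integral_eq_integral hi) (auto simp: h_def)
  finally show ?thesis by (simp add: hI)
qed

lemma measure_region:
  assumes "0 \<le> t" "t < 1" "0 \<le> x"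
  shows "measure lborel (region t x) = x + excess f t x"
  using emeasure_region[OF assms] excess_nonneg[of f t x] assms by (simp add: measure_def del: ennreal_plus)

text \<open>The larger region adds at most a horizontal strip of height x' - x over the whole unit
  interval and a vertical one of width t' - t below the curve, where f is at most f c.\<close>

lemma measure_region_le:
  assumes "0 \<le> t" "t \<le> t'" "t' \<le> c" "c < 1" "0 \<le> x" "x \<le> x'"
  shows "measure lborel (region t' x') \<le> measure lborel (region t x) + (x' - x) + (t' - t) * f c"
proof -
  have "excess f t' x' \<le> excess f t' x"
    unfolding excess_def using assms by (intro set_integral_mono set_integrable_f_Icc) auto
  also have "excess f t' x = excess f t x + (LBINT s:{t..t'}. max 0 (f s - x))"
    unfolding excess_def using assms by (intro set_integral_Icc_add set_integrable_f_Icc) auto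
  also have "(LBINT s:{t..t'}. max 0 (f s - x)) \<le> (LBINT s:{t..t'}. f c)"
  proof (intro set_integral_mono)
    show "set_integrable lborel {t..t'} (\<lambda>s. max 0 (f s - x))"
      by (rule set_integrable_subset[OF set_integrable_f_Icc(3)[of t']]) (use assms in auto)
    show "set_integrable lborel {t..t'} (\<lambda>s. f c)"
      by (intro set_integrable_bounded[OF _ _ _ order.refl]) (use assms in \<open>auto simp: emeasure_lborel_Icc_eq\<close>)
    show "max 0 (f s - x) \<le> f c" if "s \<in> {t..t'}" for s
      using that assms f_mono[of s c] f_nonneg[of c] by auto
  qed
  also have "(LBINT s:{t..t'}. f c) = (t' - t) * f c" using assms by (subst set_integral_const) auto
  finally show ?thesis using assms by (simp add: measure_region)
qed

text \<open>For A below the curve, the density of winning atoms integrated over A; the mesh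
  estimates tie it to probabilities.\<close>

definition wins :: "(real \<times> real) set \<Rightarrow> real" where
  "wins A = (LINT p:A|lborel. case_prod (survival 1 f) p)"

lemma survival_region:
  "0 \<le> t \<Longrightarrow> t < 1 \<Longrightarrow> 0 \<le> x \<Longrightarrow> survival 1 f t x = exp (- measure lborel (region t x))"
  by (simp add: survival_def measure_region)

lemma measurable_survival_lborel [measurable]:
  "case_prod (survival 1 f) \<in> borel_measurable borel"
  using measurable_survival[OF f_meas] by (simp add: borel_prod)

lemma set_integrable_survival_prod:
  assumes "A \<in> sets borel" "A \<subseteq> {0..1} \<times> {0..K}"
  shows "set_integrable lborel A (case_prod (survival 1 f))"
proof (rule set_integrable_bounded[where B=1])
  have "emeasure lborel A \<le> emeasure lborel ({0..1::real} \<times> {0..K})"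
    using assms by (intro emeasure_mono) (auto intro: borel_Times)
  also have "\<dots> = emeasure lborel {0..1::real} * emeasure lborel {0..K}"
    unfolding lborel_prod[symmetric] by (intro lborel.emeasure_pair_measure_Times) auto
  also have "\<dots> < \<infinity>" by (auto simp: emeasure_lborel_Icc_eq ennreal_mult_less_top)
  finally show "emeasure lborel A < \<infinity>" .
  show "\<bar>case_prod (survival 1 f) p\<bar> \<le> 1" if "p \<in> A" for p
    using that assms survival_le_1[of 1 "snd p" f "fst p"] survival_pos[of 1 f "fst p" "snd p"]
    by (auto simp: case_prod_unfold less_imp_le)
qed (use assms in auto)

lemma wins_subgraph:
  assumes c: "0 \<le> c" "c < 1"
  shows "wins {(t, x). 0 \<le> t \<and> t < c \<and> 0 \<le> x \<and> x \<le> f t} = (LBINT t:{0..<c}. rate 1 f t)"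
proof -
  define A where "A = {(t, x). 0 \<le> t \<and> t < c \<and> 0 \<le> x \<and> x \<le> f t}"
  have "A = {p. 0 \<le> fst p \<and> fst p < c \<and> 0 \<le> snd p \<and> snd p \<le> f (fst p)}" by (auto simp: A_def)
  also have "\<dots> \<in> sets borel" by (rule borel_Collect_prod) measurable
  finally have A: "A \<in> sets borel" .
  have "A \<subseteq> {0..1} \<times> {0..f c}" using c f_mono[of _ c] by (fastforce simp: A_def)
  then have int: "integrable (lborel \<Otimes>\<^sub>M lborel) (\<lambda>p. indicator A p *\<^sub>R case_prod (survival 1 f) p)"
    using set_integrable_survival_prod[OF A] by (simp add: set_integrable_def lborel_prod)
  have "wins A = (LINT p|(lborel \<Otimes>\<^sub>M lborel). indicator A p *\<^sub>R case_prod (survival 1 f) p)"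
    by (simp add: wins_def set_lebesgue_integral_def lborel_prod)
  also have "\<dots> = (LBINT t. LBINT x. indicator A (t, x) *\<^sub>R case_prod (survival 1 f) (t, x))"
    using lborel_pair.integral_fst'[OF int] by simp
  also have "\<dots> = (LBINT t:{0..<c}. rate 1 f t)"
    unfolding rate_def set_lebesgue_integral_def
  proof (intro Bochner_Integration.integral_cong refl)
    fix t
    have "(LBINT x. indicator A (t, x) *\<^sub>R case_prod (survival 1 f) (t, x)) =
      (LBINT x. indicator {0..<c} t * (indicator {0..f t} x *\<^sub>R survival 1 f t x))"
      by (intro Bochner_Integration.integral_cong) (auto simp: A_def indicator_def)
    then show "(LBINT x. indicator A (t, x) *\<^sub>R case_prod (survival 1 f) (t, x)) =
      indicator {0..<c} t *\<^sub>R (LBINT x. indicator {0..f t} x *\<^sub>R survival 1 f t x)" by simp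
  qed
  finally show ?thesis by (simp add: A_def)
qed

lemma cell_subset:
  assumes "0 \<le> a" "a' \<le> c" "c < 1" "0 \<le> b"
  shows "cell a a' b b' \<subseteq> {0..1} \<times> {0..f c}"
proof
  fix p assume "p \<in> cell a a' b b'"
  then obtain s y where p: "p = (s, y)" "a \<le> s" "s < a'" "b \<le> y" "y \<le> f s"
    by (auto simp: cell_def)
  then show "p \<in> {0..1} \<times> {0..f c}" using assms f_mono[of s c] by auto
qed

text \<open>For a point of the cell, the area of its region exceeds that of the lower corner, and
  falls short of that of the upper corner, by at most \<kappa>. So \<open>survival\<close> may be
  replaced by its corner values at the price of a factor exp \<kappa>.\<close>

lemma cell_estimates:
  assumes a: "0 \<le> a" "a \<le> a'" "a' \<le> c" "c < 1" and b: "0 \<le> b" "b \<le> b'"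
  defines "\<kappa> \<equiv> (b' - b) + (a' - a) * f c"
  shows "wins (cell a a' b b') \<le> exp \<kappa> * (measure lborel (cell a a' b b') * exp (- measure lborel (region a' b')))"
    and "measure lborel (cell a a' b b') * exp (- measure lborel (region a b)) \<le> exp \<kappa> * wins (cell a a' b b')"
proof -
  define C where "C = cell a a' b b'"
  have C: "C \<in> sets borel" "C \<subseteq> {0..1} \<times> {0..f c}"
  proof -
    show "C \<in> sets borel" by (simp add: C_def)
    show "C \<subseteq> {0..1} \<times> {0..f c}" unfolding C_def using a b by (intro cell_subset) auto
  qed
  have int: "set_integrable lborel C (case_prod (survival 1 f))" by (rule set_integrable_survival_prod[OF C])
  have "emeasure lborel C \<le> emeasure lborel ({0..1::real} \<times> {0..f c})"
    using C by (intro emeasure_mono) (auto intro: borel_Times)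
  also have "\<dots> = emeasure lborel {0..1::real} * emeasure lborel {0..f c}"
    unfolding lborel_prod[symmetric] by (intro lborel.emeasure_pair_measure_Times) auto
  also have "\<dots> < \<infinity>" by (auto simp: emeasure_lborel_Icc_eq ennreal_mult_less_top)
  finally have fin: "emeasure lborel C < \<infinity>" .
  have ci: "set_integrable lborel C (\<lambda>_. z)" for z :: real
    by (rule set_integrable_bounded[OF _ _ _ order.refl]) (use C fin in auto)
  have cI: "(LINT p:C|lborel. z) = measure lborel C * z" for z :: real
    using C fin by (subst set_integral_const) auto
  have up: "measure lborel (region a' b') \<le> measure lborel (region t x) + \<kappa>"
    and lo: "measure lborel (region t x) \<le> measure lborel (region a b) + \<kappa>"
    and s: "survival 1 f t x = exp (- measure lborel (region t x))" if "(t, x) \<in> C" for t x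
  proof -
    have p: "a \<le> t" "t \<le> a'" "b \<le> x" "x \<le> b'" using that by (auto simp: C_def cell_def)
    have "(a' - t) * f c \<le> (a' - a) * f c" "(t - a) * f c \<le> (a' - a) * f c"
      using p f_nonneg by (auto intro!: mult_right_mono)
    then show "measure lborel (region a' b') \<le> measure lborel (region t x) + \<kappa>"
      "measure lborel (region t x) \<le> measure lborel (region a b) + \<kappa>"
      using measure_region_le[of t a' c x b'] measure_region_le[of a t c b x] p a b by (auto simp: \<kappa>_def)
    show "survival 1 f t x = exp (- measure lborel (region t x))"
      using p a b by (intro survival_region) auto
  qed
  have "wins C \<le> (LINT p:C|lborel. exp (\<kappa> - measure lborel (region a' b')))"
    unfolding wins_def using up s by (intro set_integral_mono int ci) (auto, smt (verit))
  then show "wins (cell a a' b b') \<le> exp \<kappa> * (measure lborel (cell a a' b b') * exp (- measure lborel (region a' b')))"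
    unfolding cI C_def[symmetric] by (simp add: exp_diff exp_minus field_simps)
  have "(LINT p:C|lborel. exp (- \<kappa> - measure lborel (region a b))) \<le> wins C"
    unfolding wins_def using lo s by (intro set_integral_mono int ci) (auto, smt (verit))
  then show "measure lborel (cell a a' b b') * exp (- measure lborel (region a b)) \<le> exp \<kappa> * wins (cell a a' b b')"
    unfolding cI C_def[symmetric] by (simp add: exp_diff exp_minus field_simps)
qed

end

section \<open>Success in terms of empty regions\<close>

locale poisson_curve = curve f + unit_rate_process M X
  for f and M :: "'a measure" and X
begin

definition win :: "'a set" where
  "win = {\<omega> \<in> space M. fst (stopping_point f (X \<omega>)) = fst (best_atom (X \<omega>))}"

lemma bounded_region_region:
  assumes "0 \<le> t" "t < 1" "0 \<le> x"
  shows "bounded_region (region t x)"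
proof -
  have "region t x \<subseteq> strip" by (auto simp: region_def)
  then show ?thesis using emeasure_region[OF assms] by (simp add: bounded_region_def)
qed

lemma bounded_region_cell:
  assumes "0 \<le> a" "a' \<le> c" "c < 1" "0 \<le> b"
  shows "bounded_region (cell a a' b b')"
  by (rule bounded_region_subset[OF bounded_region_box(1)[of 0 1 "f c"]])
    (use cell_subset[OF assms] in \<open>auto simp: f_nonneg\<close>)

text \<open>Requiring the enlarged region to be empty also excludes ties, so no null set has to be removed.\<close>

lemma best_atom_in_cell:
  assumes \<omega>: "\<omega> \<in> space M" and one: "card (X \<omega> \<inter> cell a a' b b') = 1"
    and empty: "X \<omega> \<inter> (region a' b' - cell a a' b b') = {}"
    and ab: "0 \<le> a" "a' < 1" "0 \<le> b"
  shows "best_atom (X \<omega>) \<in> cell a a' b b'" and "\<omega> \<in> win"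
proof -
  obtain p where p: "X \<omega> \<inter> cell a a' b b' = {p}" using one by (auto simp: card_1_singleton_iff)
  have pc: "p \<in> X \<omega>" "p \<in> cell a a' b b'" using p by auto
  have eq: "q = p" if "q \<in> X \<omega>" "q \<in> region a' b'" for q using that empty p by blast
  have strip: "q \<in> strip" if "q \<in> X \<omega>" for q using that X_strip[OF \<omega>] by auto
  have best: "best_atom (X \<omega>) = p"
    unfolding best_atom_def
  proof (rule arg_min_eqI)
    fix q assume q: "q \<in> X \<omega>" "snd q \<le> snd p"
    then have "q \<in> region a' b'"
      using strip[OF q(1)] pc by (auto simp: region_def cell_def)
    then show "q = p" by (rule eq[OF q(1)])
  qed (fact pc)
  have sub: "p \<in> X \<omega> \<inter> subgraph f" using pc ab by (auto simp: cell_def subgraph_def)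
  have "(ARG_MIN fst q. q \<in> X \<omega> \<inter> subgraph f) = p"
  proof (rule arg_min_eqI)
    fix q assume q: "q \<in> X \<omega> \<inter> subgraph f" "fst q \<le> fst p"
    then have "q \<in> region a' b'" using pc by (auto simp: region_def cell_def subgraph_def)
    then show "q = p" using q eq by blast
  qed (fact sub)
  then have "fst (stopping_point f (X \<omega>)) = fst p"
    using sub by (auto simp: stopping_point_def)
  then show "best_atom (X \<omega>) \<in> cell a a' b b'" "\<omega> \<in> win" using best pc \<omega> by (auto simp: win_def)
qed

text \<open>Local finiteness makes both minima genuine. Minimality of the score empties the part of
  the region below x, minimality of the arrival time the part below the curve before t.\<close>

lemma best_atom_empty_region:
  assumes \<omega>: "\<omega> \<in> win" and fin: "\<And>n::nat. finite (X \<omega> \<inter> {0..1} \<times> {0..real n})"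
    and ne: "X \<omega> \<noteq> {}" and not1: "X \<omega> \<inter> {1} \<times> {0..} = {}"
  obtains t x where "(t, x) \<in> X \<omega>" "0 \<le> t" "t < 1" "0 \<le> x" "x \<le> f t" "X \<omega> \<inter> region t x = {}"
proof -
  have sp: "\<omega> \<in> space M" and eq: "fst (stopping_point f (X \<omega>)) = fst (best_atom (X \<omega>))"
    using \<omega> by (auto simp: win_def)
  have strip: "0 \<le> s \<and> s \<le> 1 \<and> 0 \<le> y" if "(s, y) \<in> X \<omega>" for s y using that X_strip[OF sp] by auto
  have fin': "finite (X \<omega> \<inter> {0..1} \<times> {0..K})" for K
  proof -
    obtain n where "K \<le> real n" using real_arch_simple by blast
    then show ?thesis by (intro finite_subset[OF _ fin[of n]]) auto
  qed
  obtain q0 where q0: "q0 \<in> X \<omega>" using ne by auto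
  define p where "p = best_atom (X \<omega>)"
  have f1: "finite {q. q \<in> X \<omega> \<and> snd q \<le> snd q0}"
    by (rule finite_subset[OF _ fin'[of "snd q0"]]) (use strip in auto)
  have pX: "p \<in> X \<omega>" and pmin: "\<And>q. q \<in> X \<omega> \<Longrightarrow> snd p \<le> snd q"
    unfolding p_def best_atom_def
    using arg_min_locally_finite[of "\<lambda>q. q \<in> X \<omega>" q0 snd, OF q0 f1] by auto
  obtain t x where tx: "p = (t, x)" by (cases p)
  have t: "0 \<le> t" "t < 1" "0 \<le> x"
  proof -
    have "(t, x) \<in> X \<omega>" using pX tx by simp
    then have b: "0 \<le> t \<and> t \<le> 1 \<and> 0 \<le> x" by (rule strip)
    have "t \<noteq> 1"
    proof
      assume "t = 1"
      then have "(t, x) \<in> X \<omega> \<inter> {1} \<times> {0..}" using b \<open>(t, x) \<in> X \<omega>\<close> by simp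
      then show False unfolding not1 by simp
    qed
    with b show "0 \<le> t" "t < 1" "0 \<le> x" by auto
  qed
  \<comment> \<open>Otherwise the stopping time would be the default 1, whereas t < 1.\<close>
  have "X \<omega> \<inter> subgraph f \<noteq> {}"
    using eq t tx by (auto simp: stopping_point_def p_def[symmetric])
  then obtain q1 where q1: "q1 \<in> X \<omega> \<inter> subgraph f" by auto
  define r where "r = (ARG_MIN fst q. q \<in> X \<omega> \<inter> subgraph f)"
  \<comment> \<open>The whole subgraph may hold infinitely many atoms near time 1, but those
    arriving no later than \<open>q1\<close> lie below height f (fst q1).\<close>
  have f2: "finite {q. q \<in> X \<omega> \<inter> subgraph f \<and> fst q \<le> fst q1}"
  proof (rule finite_subset[OF _ fin'[of "f (fst q1)"]], rule subrelI)
    fix s y assume "(s, y) \<in> {q. q \<in> X \<omega> \<inter> subgraph f \<and> fst q \<le> fst q1}"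
    then have sy: "(s, y) \<in> X \<omega>" "(s, y) \<in> subgraph f" "fst (s, y) \<le> fst q1" by auto
    have "f s \<le> f (fst q1)" using sy q1 by (intro f_mono) (auto simp: subgraph_def)
    then show "(s, y) \<in> X \<omega> \<inter> {0..1} \<times> {0..f (fst q1)}" using sy by (auto simp: subgraph_def)
  qed
  have rX: "r \<in> X \<omega> \<inter> subgraph f" and rmin: "\<And>q. q \<in> X \<omega> \<inter> subgraph f \<Longrightarrow> fst r \<le> fst q"
    unfolding r_def using arg_min_locally_finite[of "\<lambda>q. q \<in> X \<omega> \<inter> subgraph f" q1 fst, OF q1 f2] by auto
  have "fst r = t"
    using eq q1 tx by (auto simp: stopping_point_def r_def p_def[symmetric])
  \<comment> \<open>Success compares arrival times only, so \<open>r\<close> and \<open>p\<close>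
    could be different atoms at one time. As \<open>p\<close> has the smallest score, still x \<le>
    snd r \<le> f t.\<close>
  then have xf: "x \<le> f t"
    using pmin[of r] rX tx by (auto simp: subgraph_def)
  have "X \<omega> \<inter> region t x = {}"
  proof (rule ccontr)
    assume "X \<omega> \<inter> region t x \<noteq> {}"
    then obtain s y where sy: "(s, y) \<in> X \<omega>" "(s, y) \<in> region t x" by auto
    have "\<not> y < x" using pmin[OF sy(1)] tx by auto
    then have "s < t" "y \<le> f s" using sy(2) by (auto simp: region_def)
    then have "(s, y) \<in> X \<omega> \<inter> subgraph f" using sy t by (auto simp: subgraph_def region_def)
    then show False using rmin[of "(s, y)"] \<open>fst r = t\<close> \<open>s < t\<close> by auto
  qed
  then show thesis using that pX tx t xf by auto
qed

section \<open>Discretisation before a time c < 1, where the curve is bounded by f c\<close>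

context
  fixes c :: real and n :: nat
  assumes c: "0 < c" "c < 1" and n: "0 < n"
begin

definition mesh_t :: "nat \<Rightarrow> real" where "mesh_t i = c * real i / real n"
text \<open>The total height f c + 1 is positive and strictly above the curve, so the half-open
  cells also cover points on the curve.\<close>

definition mesh_x :: "nat \<Rightarrow> real" where "mesh_x i = (f c + 1) * real i / real n"
text \<open>The \<kappa> of \<open>cell_estimates\<close>, the same for all cells of the
  mesh.\<close>

definition mesh_error :: real where "mesh_error = ((f c + 1) + c * f c) / real n"
definition mesh_cell :: "nat \<times> nat \<Rightarrow> (real \<times> real) set" where
  "mesh_cell ij = cell (mesh_t (fst ij)) (mesh_t (Suc (fst ij))) (mesh_x (snd ij)) (mesh_x (Suc (snd ij)))"

abbreviation "grid \<equiv> {..<n} \<times> {..<n}"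

lemma grid_bounds:
  assumes "i < n"
  shows "0 \<le> mesh_t i" "mesh_t i \<le> mesh_t (Suc i)" "mesh_t (Suc i) \<le> c" "mesh_t (Suc i) < 1" "0 \<le> mesh_x i" "mesh_x i \<le> mesh_x (Suc i)"
    "(mesh_x (Suc j) - mesh_x j) + (mesh_t (Suc i) - mesh_t i) * f c = mesh_error"
proof -
  show "0 \<le> mesh_t i" "mesh_t i \<le> mesh_t (Suc i)" "0 \<le> mesh_x i" "mesh_x i \<le> mesh_x (Suc i)"
    using c n f_nonneg[of c] by (auto simp: mesh_t_def mesh_x_def intro!: divide_right_mono mult_left_mono)
  have "c * real (Suc i) \<le> c * real n" using assms c by (intro mult_left_mono) auto
  then show "mesh_t (Suc i) \<le> c" using n by (simp add: mesh_t_def divide_simps)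
  then show "mesh_t (Suc i) < 1" using c by simp
  show "(mesh_x (Suc j) - mesh_x j) + (mesh_t (Suc i) - mesh_t i) * f c = mesh_error"
    using n by (simp add: mesh_t_def mesh_x_def mesh_error_def field_simps)
qed

lemma mesh_unique:
  assumes "d > 0" "d * real i / real n \<le> z" "z < d * real (Suc i) / real n"
    "d * real j / real n \<le> z" "z < d * real (Suc j) / real n"
  shows "i = j"
proof -
  have "d * real i < d * real (Suc j)" "d * real j < d * real (Suc i)"
    using assms n by (auto simp: field_simps)
  then show ?thesis using assms(1) by simp
qed

lemma mesh_cover:
  assumes "d > 0" "0 \<le> z" "z < d"
  obtains i where "i < n" "d * real i / real n \<le> z" "z < d * real (Suc i) / real n"
proof -
  define i where "i = nat \<lfloor>z * n / d\<rfloor>"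
  have nn: "0 \<le> z * n / d" using assms by simp
  then have i: "real i \<le> z * n / d" "z * n / d < real i + 1"
    unfolding i_def by (auto simp: of_nat_nat) 
  have "z * n / d < real n" using assms n by (simp add: field_simps)
  then have "i < n" using i by simp
  then show thesis using that[of i] i assms n by (simp add: field_simps)
qed

lemma mesh_cell_disjoint:
  assumes "p \<in> mesh_cell ij" "p \<in> mesh_cell kl"
  shows "ij = kl"
proof (rule prod_eqI)
  show "fst ij = fst kl"
    by (rule mesh_unique[of c _ "fst p"]) (use assms c in \<open>auto simp: mesh_cell_def cell_def mesh_t_def\<close>)
  show "snd ij = snd kl"
    by (rule mesh_unique[of "f c + 1" _ "snd p"])
      (use assms f_nonneg[of c] in \<open>auto simp: mesh_cell_def cell_def mesh_x_def\<close>)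
qed

lemma mesh_cell_Union: "(\<Union>ij\<in>grid. mesh_cell ij) = {(t, x). 0 \<le> t \<and> t < c \<and> 0 \<le> x \<and> x \<le> f t}"
proof (intro equalityI subsetI)
  fix p assume "p \<in> (\<Union>ij\<in>grid. mesh_cell ij)"
  then obtain i j where "i < n" "j < n" "p \<in> mesh_cell (i, j)" by auto
  then show "p \<in> {(t, x). 0 \<le> t \<and> t < c \<and> 0 \<le> x \<and> x \<le> f t}"
    using grid_bounds(1,3)[of i] grid_bounds(5)[of j] by (auto simp: mesh_cell_def cell_def)
next
  fix p assume "p \<in> {(t, x). 0 \<le> t \<and> t < c \<and> 0 \<le> x \<and> x \<le> f t}"
  then obtain t x where p: "p = (t, x)" "0 \<le> t" "t < c" "0 \<le> x" "x \<le> f t" by auto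
  have "x < f c + 1" using p c f_mono[of t c] by auto
  obtain i where i: "i < n" "c * real i / real n \<le> t" "t < c * real (Suc i) / real n"
    using mesh_cover[of c t] p c by auto
  obtain j where j: "j < n" "(f c + 1) * real j / real n \<le> x" "x < (f c + 1) * real (Suc j) / real n"
    using mesh_cover[of "f c + 1" x] p \<open>x < f c + 1\<close> f_nonneg[of c] by auto
  have "p \<in> mesh_cell (i, j)" using i j p by (auto simp: mesh_cell_def cell_def mesh_t_def mesh_x_def)
  then show "p \<in> (\<Union>ij\<in>grid. mesh_cell ij)" using i j by blast
qed

lemma wins_mesh_cells: "(\<Sum>ij\<in>grid. wins (mesh_cell ij)) = (LBINT t:{0..<c}. rate 1 f t)"
proof -
  have "wins (\<Union>ij\<in>grid. mesh_cell ij) = (\<Sum>ij\<in>grid. wins (mesh_cell ij))"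
    unfolding wins_def
  proof (rule set_integral_finite_Union)
    show "disjoint_family_on mesh_cell grid"
      using mesh_cell_disjoint by (auto simp: disjoint_family_on_def)
    fix ij assume "ij \<in> grid"
    then show "set_integrable lborel (mesh_cell ij) (case_prod (survival 1 f))"
      unfolding mesh_cell_def using grid_bounds(1,3)[of "fst ij"] grid_bounds(5)[of "snd ij"] c
      by (intro set_integrable_survival_prod[where K="f c"] cell_subset) auto
  qed (auto simp: mesh_cell_def)
  then show ?thesis using wins_subgraph[of c] mesh_cell_Union c by simp
qed

text \<open>For each cell, take the event that it holds exactly one atom and the region of its upper
  corner no other. Each of these implies a success; they are disjoint, and their probabilities add
  up to the bound.\<close>

lemma lower_event:
  "\<exists>A\<in>events. A \<subseteq> win \<and> exp (- mesh_error) * (LBINT t:{0..<c}. rate 1 f t) \<le> prob A"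
proof -
  define R where "R ij = region (mesh_t (Suc (fst ij))) (mesh_x (Suc (snd ij)))" for ij
  define L where "L ij = single (mesh_cell ij) \<inter> void (R ij - mesh_cell ij)" for ij
  have *: "L ij \<in> events \<and> exp (- mesh_error) * wins (mesh_cell ij) \<le> prob (L ij) \<and>
      (\<forall>\<omega>\<in>L ij. best_atom (X \<omega>) \<in> mesh_cell ij \<and> \<omega> \<in> win)" if ij: "ij \<in> grid" for ij
  proof -
    obtain i j where e: "ij = (i, j)" "i < n" "j < n" using ij by auto
    note gi = grid_bounds[OF e(2)] and gj = grid_bounds[OF e(3)]
    have bR: "bounded_region (R ij)"
      unfolding R_def e using gi gj by (intro bounded_region_region) auto
    have bC: "bounded_region (mesh_cell ij)"
      unfolding mesh_cell_def e using gi gj c by (intro bounded_region_cell[where c=c]) auto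
    have sub: "mesh_cell ij \<subseteq> R ij"
      using gi gj by (auto simp: mesh_cell_def R_def e cell_def region_def)
    have bD: "bounded_region (R ij - mesh_cell ij)"
      by (rule bounded_region_subset[OF bR]) (use bR bC in \<open>auto simp: bounded_region_def\<close>)
    have m: "measure lborel (mesh_cell ij) + measure lborel (R ij - mesh_cell ij) = measure lborel (R ij)"
      using measure_Diff[of lborel "R ij" "mesh_cell ij"] bR bC sub by (auto simp: bounded_region_def)
    have "prob (L ij) = measure lborel (mesh_cell ij) * exp (- measure lborel (R ij))"
      unfolding L_def using prob_single_void[OF bC bD] m by auto
    moreover have "wins (mesh_cell ij) \<le> exp mesh_error * (measure lborel (mesh_cell ij) * exp (- measure lborel (R ij)))"
      unfolding mesh_cell_def R_def e using cell_estimates(1)[of "mesh_t i" "mesh_t (Suc i)" c "mesh_x j" "mesh_x (Suc j)"] gi gj c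
      by simp
    ultimately have "exp (- mesh_error) * wins (mesh_cell ij) \<le> exp (- mesh_error) * (exp mesh_error * prob (L ij))"
      by (intro mult_left_mono) auto
    then have 1: "exp (- mesh_error) * wins (mesh_cell ij) \<le> prob (L ij)"
      by (simp flip: mult.assoc exp_add)
    have 2: "L ij \<in> events"
      unfolding L_def using bC bD by (intro sets.Int events) (auto simp: bounded_region_def)
    have 3: "best_atom (X \<omega>) \<in> mesh_cell ij \<and> \<omega> \<in> win" if "\<omega> \<in> L ij" for \<omega>
      using that best_atom_in_cell[of \<omega> "mesh_t i" "mesh_t (Suc i)" "mesh_x j" "mesh_x (Suc j)"] gi gj
      by (auto simp: L_def mesh_cell_def R_def e single_def void_def)
    show ?thesis using 1 2 3 by blast
  qed
  \<comment> \<open>On \<open>L ij\<close> the best atom lies in that cell, and the cells are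
    disjoint.\<close>
  have "disjoint_family_on L grid"
    unfolding disjoint_family_on_def
  proof (intro ballI impI)
    fix ij kl assume "ij \<in> grid" "kl \<in> grid" "ij \<noteq> kl"
    then show "L ij \<inter> L kl = {}" using * mesh_cell_disjoint by blast
  qed
  then have "prob (\<Union>ij\<in>grid. L ij) = (\<Sum>ij\<in>grid. prob (L ij))"
    using * by (intro finite_measure_finite_Union) auto
  also have "\<dots> \<ge> (\<Sum>ij\<in>grid. exp (- mesh_error) * wins (mesh_cell ij))"
    using * by (intro sum_mono) auto
  finally have "exp (- mesh_error) * (LBINT t:{0..<c}. rate 1 f t) \<le> prob (\<Union>ij\<in>grid. L ij)"
    by (simp only: wins_mesh_cells flip: sum_distrib_left)
  moreover have "(\<Union>ij\<in>grid. L ij) \<in> events" using * by (intro sets.finite_UN) auto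
  moreover have "(\<Union>ij\<in>grid. L ij) \<subseteq> win" using * by blast
  ultimately show ?thesis by blast
qed

text \<open>Up to a null set, the winning atom of a success lies in a mesh cell and leaves the
  region of the lower corner empty (\<open>U\<close>), or arrives from c on with score at most K
  (\<open>V1\<close>), or has a score above K, so that no atom has score at most K
  (\<open>V2\<close>).\<close>

lemma upper_event:
  assumes K: "0 \<le> K"
  shows "\<exists>B\<in>events. win \<subseteq> B \<and>
    prob B \<le> exp mesh_error * (LBINT t:{0..<c}. rate 1 f t) + (1 - c) * K + exp (- K)"
proof -
  define R where "R ij = region (mesh_t (fst ij)) (mesh_x (snd ij))" for ij
  define U where "U ij = (space M - void (mesh_cell ij)) \<inter> void (R ij)" for ij
  define V1 where "V1 = space M - void ({c..1} \<times> {0..K})"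
  define V2 where "V2 = void ({0..1} \<times> {0..K})"
  have box: "bounded_region ({c..1} \<times> {0..K})" "bounded_region ({0..1} \<times> {0..K})"
    using c K by (auto intro!: bounded_region_box)
  have V: "V1 \<in> events" "V2 \<in> events"
    unfolding V1_def V2_def using box by (auto intro!: events sets.Diff simp: bounded_region_def)
  have pV: "prob V1 \<le> (1 - c) * K" "prob V2 = exp (- K)"
    using prob_nonvoid[OF box(1)] prob_void[OF box(2)] bounded_region_box(2)[of c 1 K]
      bounded_region_box(2)[of 0 1 K] c K by (auto simp: V1_def V2_def)
  have *: "U ij \<in> events \<and> prob (U ij) \<le> exp mesh_error * wins (mesh_cell ij)" if ij: "ij \<in> grid" for ij
  proof -
    obtain i j where e: "ij = (i, j)" "i < n" "j < n" using ij by auto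
    note gi = grid_bounds[OF e(2)] and gj = grid_bounds[OF e(3)]
    have bR: "bounded_region (R ij)"
      unfolding R_def e using gi gj by (intro bounded_region_region) auto
    have bC: "bounded_region (mesh_cell ij)"
      unfolding mesh_cell_def e using gi gj c by (intro bounded_region_cell[where c=c]) auto
    have disj: "mesh_cell ij \<inter> R ij = {}"
      by (auto simp: mesh_cell_def R_def e cell_def region_def)
    have "prob (U ij) \<le> measure lborel (mesh_cell ij) * exp (- measure lborel (R ij))"
      unfolding U_def by (rule prob_nonvoid_void[OF bC bR disj])
    also have "\<dots> \<le> exp mesh_error * wins (mesh_cell ij)"
      unfolding mesh_cell_def R_def e using cell_estimates(2)[of "mesh_t i" "mesh_t (Suc i)" c "mesh_x j" "mesh_x (Suc j)"] gi gj c
      by simp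
    moreover have "U ij \<in> events"
      unfolding U_def using bC bR by (intro sets.Int sets.Diff events) (auto simp: bounded_region_def)
    ultimately show ?thesis by simp
  qed
  have "AE \<omega> in M. \<forall>n::nat. finite (X \<omega> \<inter> {0..1} \<times> {0..real n})"
    unfolding AE_all_countable using AE_finite bounded_region_box(1) by auto
  then have "AE \<omega> in M. (\<forall>n::nat. finite (X \<omega> \<inter> {0..1} \<times> {0..real n})) \<and> X \<omega> \<noteq> {} \<and> X \<omega> \<inter> {1} \<times> {0..} = {}"
    using AE_nonempty AE_not_at_1 by eventually_elim simp
  then obtain N where N: "{\<omega> \<in> space M. \<not> ((\<forall>n::nat. finite (X \<omega> \<inter> {0..1} \<times> {0..real n})) \<and> X \<omega> \<noteq> {} \<and> X \<omega> \<inter> {1} \<times> {0..} = {})} \<subseteq> N"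
      "emeasure M N = 0" "N \<in> events" by (rule AE_E)
  define B where "B = (\<Union>ij\<in>grid. U ij) \<union> V1 \<union> V2 \<union> N"
  have Bev: "B \<in> events" unfolding B_def using * V N by (intro sets.Un sets.finite_UN) auto
  have "win \<subseteq> B"
  proof
    fix \<omega> assume \<omega>: "\<omega> \<in> win"
    then have sp: "\<omega> \<in> space M" by (simp add: win_def)
    show "\<omega> \<in> B"
    proof (cases "\<omega> \<in> N")
      case False
      then have g: "(\<forall>n::nat. finite (X \<omega> \<inter> {0..1} \<times> {0..real n})) \<and> X \<omega> \<noteq> {} \<and> X \<omega> \<inter> {1} \<times> {0..} = {}"
        using N(1) sp by blast
      obtain t x where tx: "(t, x) \<in> X \<omega>" "0 \<le> t" "t < 1" "0 \<le> x" "x \<le> f t" "X \<omega> \<inter> region t x = {}"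
        using best_atom_empty_region[OF \<omega>] g by metis
      show ?thesis
      proof (cases "t < c")
        case True
        then have "(t, x) \<in> (\<Union>ij\<in>grid. mesh_cell ij)" unfolding mesh_cell_Union using tx by auto
        then obtain ij where ij: "ij \<in> grid" "(t, x) \<in> mesh_cell ij" by blast
        then have "R ij \<subseteq> region t x" by (auto simp: R_def mesh_cell_def cell_def region_def)
        then have "\<omega> \<in> U ij" using ij tx sp by (auto simp: U_def void_def)
        then show ?thesis using ij by (auto simp: B_def)
      next
        case False
        show ?thesis
        proof (cases "x \<le> K")
          case True
          then have "\<omega> \<in> V1" using False tx sp by (auto simp: V1_def void_def)
          then show ?thesis by (simp add: B_def)
        next
          case False
          then have "{0..1} \<times> {0..K} \<subseteq> region t x" by (auto simp: region_def)
          then have "\<omega> \<in> V2" using tx sp by (auto simp: V2_def void_def)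
          then show ?thesis by (simp add: B_def)
        qed
      qed
    qed (simp add: B_def)
  qed
  moreover have "prob B \<le> exp mesh_error * (LBINT t:{0..<c}. rate 1 f t) + (1 - c) * K + exp (- K)"
  proof -
    have "prob (\<Union>ij\<in>grid. U ij) \<le> (\<Sum>ij\<in>grid. prob (U ij))"
      using * by (intro finite_measure_subadditive_finite) auto
    also have "\<dots> \<le> (\<Sum>ij\<in>grid. exp mesh_error * wins (mesh_cell ij))" using * by (intro sum_mono) auto
    also have "\<dots> = exp mesh_error * (LBINT t:{0..<c}. rate 1 f t)"
      by (simp only: wins_mesh_cells flip: sum_distrib_left)
    finally have 1: "prob (\<Union>ij\<in>grid. U ij) \<le> \<dots>" .
    have Uev: "(\<Union>ij\<in>grid. U ij) \<in> events" using * by (intro sets.finite_UN) auto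
    have "prob B \<le> prob ((\<Union>ij\<in>grid. U ij) \<union> V1 \<union> V2) + prob N"
      unfolding B_def using Uev V N by (intro measure_Un_le) auto
    also have "\<dots> \<le> prob ((\<Union>ij\<in>grid. U ij) \<union> V1) + prob V2 + prob N"
      using measure_Un_le[of "(\<Union>ij\<in>grid. U ij) \<union> V1" M V2] Uev V by auto
    also have "\<dots> \<le> prob (\<Union>ij\<in>grid. U ij) + prob V1 + prob V2 + prob N"
      using measure_Un_le[of "(\<Union>ij\<in>grid. U ij)" M V1] Uev V by auto
    also have "prob N = 0" using N by (simp add: measure_def)
    finally show ?thesis using 1 pV by simp
  qed
  ultimately show ?thesis using Bev by blast
qed

end

theorem success_prob_eq: "success_prob M X f = total_rate f"
proof -
  have "measure (completion M) win = total_rate f"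
  proof (rule completion_measure_sandwich)
    fix e :: real assume e: "0 < e"
    \<comment> \<open>The budget is e / 4 per error: exp (- K) \<le> 1 / K = e / 4, then d \<le>
      \<open>e\<^sup>2 / 16\<close> gives d * K \<le> e / 4, and d \<le> e / 4 bounds the winning
      rate after c. The 1 / 2 keeps c positive.\<close>
    define K where "K = 4 / e"
    define d where "d = min (1 / 2) (min (e / 4) (e\<^sup>2 / 16))"
    define c where "c = 1 - d"
    define I where "I = (LBINT t:{0..<c}. rate 1 f t)"
    have d: "0 < d" "d \<le> 1 / 2" "d \<le> e / 4" "d \<le> e\<^sup>2 / 16" using e by (auto simp: d_def)
    have "d * K \<le> e\<^sup>2 / 16 * K" using d(4) e by (intro mult_right_mono) (auto simp: K_def)
    then have dK: "d * K \<le> e / 4" using e by (simp add: K_def power2_eq_square)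
    have c: "0 < c" "c < 1" using d by (auto simp: c_def)
    have K: "0 \<le> K" "exp (- K) \<le> e / 4"
    proof -
      show "0 \<le> K" using e by (simp add: K_def)
      have "K \<le> exp K" using exp_ge_add_one_self[of K] by linarith
      then show "exp (- K) \<le> e / 4" using e by (simp add: K_def exp_minus field_simps)
    qed
    have r1: "rate 1 f s \<le> 1" for s
      using rate_le[OF f_meas f_nonneg, of s] exp_gt_zero[of "- f s"] by linarith
    have one: "(LBINT t:{a..<b}. rate 1 f t) \<le> b - a" if "0 \<le> a" "a \<le> b" "b \<le> 1" for a b
    proof -
      have "(LBINT t:{a..<b}. rate 1 f t) \<le> (LBINT t:{a..<b}. 1)"
        using that r1 by (intro set_integral_mono set_integrable_rate set_integrable_bounded[OF _ _ _ order.refl])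
          (auto simp: emeasure_lborel_Ico)
      then show ?thesis using that by (subst (asm) set_integral_const) auto
    qed
    have I: "0 \<le> I" "I \<le> 1" "I \<le> total_rate f" "total_rate f \<le> I + e / 4"
    proof -
      show "0 \<le> I" unfolding I_def by (intro set_integral_nonneg rate_nonneg)
      show "I \<le> 1" using one[of 0 c] c by (simp add: I_def)
      have "total_rate f = I + (LBINT t:{c..<1}. rate 1 f t)"
        unfolding total_rate_def I_def using c by (intro set_integral_Ico_add set_integrable_rate) auto
      moreover have "0 \<le> (LBINT t:{c..<1}. rate 1 f t)" by (intro set_integral_nonneg rate_nonneg)
      ultimately show "I \<le> total_rate f" "total_rate f \<le> I + e / 4"
        using one[of c 1] c d by (auto simp: c_def)
    qed
    \<comment> \<open>The mesh error tends to 0 only for fixed c, so the number of cells is chosen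
      after K and c.\<close>
    have "(\<lambda>n. exp (((f c + 1) + c * f c) / real n)) \<longlonglongrightarrow> exp 0"
      by (intro tendsto_exp lim_const_over_n)
    then have "\<forall>\<^sub>F n in sequentially. exp (((f c + 1) + c * f c) / real n) < 1 + e / 4"
      using e by (intro order_tendstoD(2)) auto
    then have "\<forall>\<^sub>F n in sequentially. 0 < n \<and> exp (((f c + 1) + c * f c) / real n) < 1 + e / 4"
      using eventually_gt_at_top[of 0] by eventually_elim auto
    then obtain n where n: "0 < n" and "exp (((f c + 1) + c * f c) / real n) < 1 + e / 4"
      by (auto simp: eventually_sequentially)
    then have k: "exp (mesh_error c n) < 1 + e / 4" by (simp add: mesh_error_def[OF c n])
    obtain A where A: "A \<in> events" "A \<subseteq> win" "exp (- mesh_error c n) * I \<le> prob A"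
      using lower_event[OF c n] by (auto simp: I_def)
    obtain B where B: "B \<in> events" "win \<subseteq> B" "prob B \<le> exp (mesh_error c n) * I + (1 - c) * K + exp (- K)"
      using upper_event[OF c n K(1)] by (auto simp: I_def)
    have "exp (mesh_error c n) * I \<le> (1 + e / 4) * I" using k I by (intro mult_right_mono) auto
    also have "\<dots> \<le> I + e / 4" using I e mult_left_le[of I "e / 4"] by (simp add: algebra_simps)
    finally have up: "prob B \<le> total_rate f + e" using B K dK I e by (simp add: c_def)
    have "1 - e / 4 \<le> exp (- mesh_error c n)"
    proof -
      have "(1 - e / 4) * exp (mesh_error c n) \<le> 1"
      proof (cases "1 - e / 4 \<le> 0")
        case True
        then have "(1 - e / 4) * exp (mesh_error c n) \<le> 0" by (simp add: mult_nonpos_nonneg)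
        then show ?thesis by simp
      next
        case False
        then have "(1 - e / 4) * exp (mesh_error c n) \<le> (1 - e / 4) * (1 + e / 4)"
          using k by (intro mult_left_mono) auto
        also have "\<dots> \<le> 1" by (simp add: algebra_simps)
        finally show ?thesis .
      qed
      then show ?thesis by (simp add: exp_minus field_simps)
    qed
    then have "(1 - e / 4) * I \<le> exp (- mesh_error c n) * I" using I by (intro mult_right_mono) auto
    moreover have "I - e / 4 \<le> (1 - e / 4) * I" using I e mult_left_le[of I "e / 4"] by (simp add: algebra_simps)
    ultimately have "total_rate f - e \<le> prob A" using A I e by linarith
    then show "\<exists>A\<in>events. \<exists>B\<in>events. A \<subseteq> win \<and> win \<subseteq> B \<and> total_rate f - e \<le> prob A \<and> prob B \<le> total_rate f + e"
      using A B up by blast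
  qed (rule finite_measure_axioms)
  then show ?thesis by (simp add: success_prob_def win_def)
qed

end

subsection \<open>Rescaled curves\<close>

text \<open>By monotonicity the supremum of the earlier values is the left limit; this settles the
  left-limit clause of \<open>threshold_curve\<close> for the rescaled curves.\<close>

lemma mono_on_left_limit:
  fixes h :: "real \<Rightarrow> real"
  assumes mono: "mono_on {0..<1} h" and t: "t \<in> {0<..<1}"
  shows "\<exists>l. (h \<longlongrightarrow> l) (at_left t)"
proof -
  have ev: "\<forall>\<^sub>F s in at_left t. s \<in> {r<..<t}" if "r < t" for r
    using eventually_at_left_real[OF that] .
  have bdd: "bdd_above (h ` {0..<t})"
    using t mono_onD[OF mono, of _ t] by (intro bdd_aboveI[of _ "h t"]) auto
  have "(h \<longlongrightarrow> Sup (h ` {0..<t})) (at_left t)"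
  proof (rule increasing_tendsto)
    show "\<forall>\<^sub>F s in at_left t. h s \<le> Sup (h ` {0..<t})"
      using ev[of 0] t by (auto elim!: eventually_mono intro!: cSup_upper bdd)
    fix y assume "y < Sup (h ` {0..<t})"
    then obtain r where r: "r \<in> {0..<t}" "y < h r"
      using less_cSup_iff[OF _ bdd, of y] t by auto
    have "\<forall>\<^sub>F s in at_left t. s \<in> {r<..<t}" using ev r by auto
    then show "\<forall>\<^sub>F s in at_left t. y < h s"
    proof eventually_elim
      case (elim s)
      then have "h r \<le> h s" using r t by (intro mono_onD[OF mono]) auto
      then show ?case using r by simp
    qed
  qed
  then show ?thesis by blast
qed

lemma threshold_curve_rescale:
  assumes L: "0 < L" and nonneg: "\<And>t. 0 \<le> k t"
    and mono: "\<And>s t. 0 \<le> s \<Longrightarrow> s \<le> t \<Longrightarrow> t < L \<Longrightarrow> k s \<le> k t"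
    and rc: "\<And>t. 0 \<le> t \<Longrightarrow> t < L \<Longrightarrow> (k \<longlongrightarrow> k t) (at_right t)"
  shows "threshold_curve (\<lambda>t. L * k (L * t))"
proof -
  have m: "mono_on {0..<1} (\<lambda>t. L * k (L * t))"
    using L by (auto simp: mono_on_def intro!: mult_left_mono mono)
  have "continuous (at_right t) (\<lambda>t. L * k (L * t))" if t: "t \<in> {0..<1}" for t
    unfolding continuous_within
  proof (intro tendsto_mult tendsto_const)
    have "filterlim (\<lambda>s. L * s) (at_right (L * t)) (at_right t)"
      unfolding filterlim_at using L by (auto intro!: tendsto_eq_intros simp: eventually_at_filter)
    then show "((\<lambda>s. k (L * s)) \<longlongrightarrow> k (L * t)) (at_right t)"
      using L t by (intro filterlim_compose[OF rc]) auto
  qed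
  then show ?thesis
    using m mono_on_left_limit[OF m] L nonneg by (auto simp: threshold_curve_def)
qed

text \<open>The map from (t, L * y) to (L * t, y) preserves area and carries the unit horizon to
  [0, L] and the rescaled curve to \<open>k\<close>. Hence the survival probabilities agree, and dx
  = L dy gives the factor L.\<close>

lemma rate_rescale:
  assumes L: "0 < L" and t: "0 \<le> t" "t < 1"
  shows "rate 1 (clip (\<lambda>t. L * k (L * t))) t = L * rate L k (L * t)"
proof -
  define h where "h = clip (\<lambda>t. L * k (L * t))"
  have ex: "excess h t (L * y) = excess k (L * t) y" for y
  proof -
    have "excess h t (L * y) = (LBINT s:{0..t}. L * max 0 (k (L * s) - y))"
      unfolding excess_def
    proof (intro set_lebesgue_integral_cong allI impI)
      fix s assume "s \<in> {0..t}"
      then have "h s = L * k (L * s)" using t by (auto simp: h_def clip_def)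
      then have "h s - L * y = L * (k (L * s) - y)" by (simp add: algebra_simps)
      then show "max 0 (h s - L * y) = L * max 0 (k (L * s) - y)"
        using L by (simp add: max_def zero_le_mult_iff mult_le_0_iff)
    qed simp
    also have "\<dots> = L * (LBINT s. indicator {0..L * t} (L * s) * max 0 (k (L * s) - y))"
      unfolding set_lebesgue_integral_def Bochner_Integration.integral_mult_right_zero[symmetric]
      using L by (intro Bochner_Integration.integral_cong) (auto simp: indicator_def zero_le_mult_iff)
    also have "\<dots> = excess k (L * t) y"
      unfolding excess_def set_lebesgue_integral_def
      using L lborel_integral_real_affine[of L "\<lambda>s. indicator {0..L * t} s * max 0 (k s - y)" 0] by simp
    finally show ?thesis .
  qed
  have ht: "h t = L * k (L * t)" using t by (simp add: h_def clip_def)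
  have "rate 1 h t = L * (LBINT y. indicator {0..h t} (L * y) * survival 1 h t (L * y))"
    unfolding rate_def set_lebesgue_integral_def
    using L lborel_integral_real_affine[of L "\<lambda>x. indicator {0..h t} x * survival 1 h t x" 0] by simp
  also have "(LBINT y. indicator {0..h t} (L * y) * survival 1 h t (L * y)) = rate L k (L * t)"
    unfolding rate_def set_lebesgue_integral_def
    using L by (intro Bochner_Integration.integral_cong)
      (auto simp: indicator_def zero_le_mult_iff ht survival_def ex)
  finally show ?thesis by (simp add: h_def)
qed

text \<open>This lets a curve on the horizon [0, L] compete on the unit interval; the factor L of
  \<open>rate_rescale\<close> is absorbed by the substitution of L * t.\<close>

lemma (in unit_rate_process) success_prob_rescale:
  assumes L: "0 < L" and h: "threshold_curve (\<lambda>t. L * k (L * t))"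
  shows "success_prob M X (\<lambda>t. L * k (L * t)) = (LBINT t:{0..<L}. rate L k t)"
proof -
  define h where "h = clip (\<lambda>t. L * k (L * t))"
  interpret h: curve h unfolding h_def by (rule curve_clip[OF h])
  interpret h: poisson_curve h M X ..
  have "success_prob M X (\<lambda>t. L * k (L * t)) = (LBINT t:{0..<1}. rate 1 h t)"
    using h.success_prob_eq by (simp add: h_def success_prob_clip total_rate_def)
  also have "\<dots> = (LBINT t:{0..<1}. L * rate L k (L * t))"
    unfolding h_def using rate_rescale[OF L] by (intro set_lebesgue_integral_cong) auto
  also have "\<dots> = L * (LBINT t. indicator {0..<L} (L * t) * rate L k (L * t))"
    unfolding set_lebesgue_integral_def Bochner_Integration.integral_mult_right_zero[symmetric]
    using L by (intro Bochner_Integration.integral_cong) (auto simp: indicator_def zero_le_mult_iff)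
  also have "\<dots> = (LBINT t:{0..<L}. rate L k t)"
    unfolding set_lebesgue_integral_def
    using L lborel_integral_real_affine[of L "\<lambda>t. indicator {0..<L} t * rate L k t" 0] by simp
  finally show ?thesis .
qed

section \<open>Optimality against the rescaled curves\<close>

theorem theorem5:
  fixes M :: "'a measure"
    and X :: "'a \<Rightarrow> (real \<times> real) set"
    and f :: "real \<Rightarrow> real"
  assumes "poisson_point_process M X unit_rate"
    and "optimal_threshold_curve M X f"
  shows "(LBINT t:{0..<1}. f t * temporal_winning_rate f t) = 1"
proof -
  define g where "g = clip f"
  have f: "threshold_curve f" using assms(2) by (simp add: optimal_threshold_curve_def)
  interpret unit_rate_process M X by unfold_locales (rule assms(1))
  interpret curve g unfolding g_def by (rule curve_clip[OF f])
  interpret poisson_curve g M X ..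
  interpret c: finite_measure "completion M"
    by (intro finite_measureI) (simp add: emeasure_completion emeasure_finite)
  have opt: "success_prob M X h \<le> total_rate g" if "threshold_curve h" for h
  proof -
    \<comment> \<open>The supremum is taken in the reals, where it is an upper bound only of a set
      bounded above.\<close>
    have "success_prob M X h' \<le> measure (completion M) (space M)" for h'
      unfolding success_prob_def using c.bounded_measure by simp
    then have "success_prob M X h \<le> (SUP h\<in>{h. threshold_curve h}. success_prob M X h)"
      using that by (intro cSUP_upper bdd_aboveI2) auto
    also have "\<dots> = total_rate g"
      using assms(2) success_prob_eq by (simp add: optimal_threshold_curve_def g_def success_prob_clip)
    finally show ?thesis .
  qed
  \<comment> \<open>Clipping preserves right continuity on [0, 1), which the rescaled competitors
    need in order to be threshold curves.\<close>
  have rc: "(g \<longlongrightarrow> g t) (at_right t)" if "0 \<le> t" "t < 1" for t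
  proof -
    have "(f \<longlongrightarrow> g t) (at_right t)"
      using f that by (auto simp: threshold_curve_def continuous_within g_def clip_def)
    moreover have "\<forall>\<^sub>F s in at_right t. f s = g s"
      using eventually_at_right_real[OF that(2)] that by (auto simp: g_def clip_def elim!: eventually_mono)
    ultimately show ?thesis using Lim_transform_eventually by blast
  qed
  have "(LBINT t:{0..<1}. g t * rate 1 g t) = 1"
  proof (rule integral_curve_rate_eq_1)
    fix c :: real assume c: "0 < c" "c < 1"
    \<comment> \<open>The competitor follows \<open>g\<close> up to time c only, stretched to the
      unit interval.\<close>
    have tc: "threshold_curve (\<lambda>t. c * g (c * t))"
      using c f_nonneg f_mono rc by (intro threshold_curve_rescale) auto
    show "(LBINT t:{0..<c}. rate c g t) \<le> total_rate g"
      using opt[OF tc] success_prob_rescale[OF c(1) tc] by simp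
  next
    fix \<epsilon> D :: real assume e: "0 < \<epsilon>" "\<epsilon> < 1" and D: "g (1 - \<epsilon>) \<le> D"
    have tc: "threshold_curve (\<lambda>t. (1 + \<epsilon>) * prolong \<epsilon> D ((1 + \<epsilon>) * t))"
    proof (rule threshold_curve_rescale)
      show "0 \<le> prolong \<epsilon> D t" for t
        using D f_nonneg[of "1 - \<epsilon>"] f_nonneg[of t] by (auto simp: prolong_def)
      show "prolong \<epsilon> D s \<le> prolong \<epsilon> D t" if "0 \<le> s" "s \<le> t" "t < 1 + \<epsilon>" for s t
        using f_mono[of s t] f_mono[of s "1 - \<epsilon>"] that e D by (auto simp: prolong_def)
      show "(prolong \<epsilon> D \<longlongrightarrow> prolong \<epsilon> D t) (at_right t)" if t: "0 \<le> t" "t < 1 + \<epsilon>" for t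
      proof (cases "t < 1 - \<epsilon>")
        case True
        then have "\<forall>\<^sub>F s in at_right t. g s = prolong \<epsilon> D s"
          using eventually_at_right_real[OF True] by (auto simp: prolong_def elim!: eventually_mono)
        then show ?thesis
          using rc[of t] True t e Lim_transform_eventually by (fastforce simp: prolong_def)
      next
        case False
        then have "\<forall>\<^sub>F s in at_right t. prolong \<epsilon> D s = D"
          by (auto simp: prolong_def eventually_at_filter)
        then show ?thesis using False by (simp add: prolong_def tendsto_eventually)
      qed
    qed (use e in auto)
    show "(LBINT t:{0..<1 + \<epsilon>}. rate (1 + \<epsilon>) (prolong \<epsilon> D) t) \<le> total_rate g"
      using opt[OF tc] success_prob_rescale[OF _ tc] e by simp
  qed
  moreover have "(LBINT t:{0..<1}. g t * rate 1 g t) = (LBINT t:{0..<1}. f t * temporal_winning_rate f t)"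
    using temporal_winning_rate_eq temporal_winning_rate_clip[of _ f]
    by (intro set_lebesgue_integral_cong) (auto simp: g_def clip_def)
  ultimately show ?thesis by simp
qed

end
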